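(* Let $\Phi=(A;\{E_i\}_{i=0}^d;A^*;\{E^*_i\}_{i=0}^d)$ be a Leonard system on $V$, with $d\ge3$ and $\mathbb F$ algebraically closed. Let $\{\theta^*_i\}_{i=0}^d$ be its dual eigenvalue sequence and $a_i=\mathrm{tr}(E^*_iA)$ for $0\le i\le d$. Write $X^-=(A-a_0I)(A^*-\theta^*_dI)$ and $X^+=(A-a_dI)(A^*-\theta^*_0I)$. Assume ${\mathcal Z}(\Phi)\neq0$. Then in each of the following cases the given element is nonzero and contained in ${\mathcal Z}(\Phi)$ (the parameters are those in the definition of the type), and moreover the given element is a basis of ${\mathcal Z}(\Phi)$, provided that $\dim{\mathcal Z}(\Phi)=1$: - $q$-Racah, $s^*=r_1^2$: $\; q^d(r_1+1)(r_1q+1)X^- - (r_1q^d+1)(r_1q^{d+1}+1)X^+$; - $q$-Racah, $s^*=r_2^2$: $\; q^d(r_2+1)(r_2q+1)X^- - (r_2q^d+1)(r_2q^{d+1}+1)X^+$; - $q$-Hahn, $s^*=r^2$: $\; q^d(r+1)(rq+1)X^- - (rq^d+1)(rq^{d+1}+1)X^+$; - dual $q$-Krawtchouk: $\; q^dX^- - X^+$; - Racah, $s^*=2r_1$: $\; X^- - X^+$; - Racah, $s^*=2r_2$: $\; X^- - X^+$; - Hahn: $\; s^*(s^*+2)X^- - (s^*+2d)(s^*+2d+2)X^+$; - Krawtchouk: $\; X^- - X^+$; - Bannai/Ito, $d$ even, $s^*=-2r_1$: $\; (r_1+1)X^- - (r_1+d+1)X^+$; - Bannai/Ito, $d$ even,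 $s^*=-2r_2$: $\; r_2X^- - (r_2+d)X^+$; - Bannai/Ito, $d$ odd, $s^*=-2r_1$: $\; r_1X^- + (r_1+d+1)X^+$; - Bannai/Ito, $d$ odd, $s^*=-2r_2$: $\; r_2X^- + (r_2+d+1)X^+$.
   Context: Let $\mathbb F$ be an algebraically closed field and $V$ a vector space over $\mathbb F$ of dimension $d+1$ with $d\ge 3$. "Scalar" means element of $\mathbb F$; integers appearing in formulas are read in $\mathbb F$. A tridiagonal matrix is irreducible if all entries on its subdiagonal and superdiagonal are nonzero. A Leonard pair on $V$ is an ordered pair $A,A^*\in \mathrm{End}(V)$ such that (i) there is a basis of $V$ with respect to which $A$ is irreducible tridiagonal and $A^*$ is diagonal; (ii) there is a basis of $V$ with respect to which $A^*$ is irreducible tridiagonal and $A$ is diagonal. Then $A,A^*$ are multiplicity-free (diagonalizable with one-dimensional eigenspaces). The primitive idempotent of $A$ for an eigenvalue $\theta$ is the projection onto the $\theta$-eigenspace along the sum of the other eigenspaces. An ordering $\{\theta_i\}_{i=0}^d$ of the eigenvalues of $A$ (and the corresponding ordering $\{E_i\}_{i=0}^d$ of primitive idempotents) is standard if corresponding eigenvectors $v_0,\dots,v_d$, in this order, form a basis as in (ii). Standard orderings for $A^*$ are defined similarly using (i). A Leonard system on $V$ is a sequence $\Phi=(A;\{E_i\}_{i=0}^d;A^*;\{E^*_i\}_{i=0}^d)$ where $A,A^*$ is a Leonard pair on $V$ and $\{E_i\}$, $\{E^*_i\}$ are standard orderings of the primitive idempotents of $A$, $A^*$. Parameter array: $\theta_i$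 (resp. $\theta^*_i$) is the eigenvalue of $A$ (resp. $A^*$) for $E_i$ (resp. $E^*_i$); $\{\theta^*_i\}$ is the dual eigenvalue sequence. For $0\ne u\in E^*_0V$ the vectors $u_i=(A-\theta_0I)\cdots(A-\theta_{i-1}I)u$ $(0\le i\le d)$ form a basis of $V$, and $A^*u_0=\theta^*_0u_0$, $A^*u_i=\theta^*_iu_i+\varphi_iu_{i-1}$ $(1\le i\le d)$ for nonzero scalars $\varphi_i$; $\{\varphi_i\}_{i=1}^d$ is the first split sequence of $\Phi$. The second split sequence $\{\phi_i\}_{i=1}^d$ is the first split sequence of the Leonard system $(A;\{E_{d-i}\}_{i=0}^d;A^*;\{E^*_i\}_{i=0}^d)$. Known facts: $I,A^*,A,AA^*,A^*A$ are linearly independent; $a_0=\theta_0+\frac{\varphi_1}{\theta^*_0-\theta^*_1}$, $a_i=\theta_i+\frac{\varphi_i}{\theta^*_i-\theta^*_{i-1}}+\frac{\varphi_{i+1}}{\theta^*_i-\theta^*_{i+1}}$ $(1\le i\le d-1)$, $a_d=\theta_d+\frac{\varphi_d}{\theta^*_d-\theta^*_{d-1}}$. Zero diagonal space: ${\mathcal Z}(\Phi)$ is the set of $X\in\mathrm{Span}\{I,A^*,A,AA^*\}$ such that $E^*_iXE^*_i=0$ for $0\le i\le d$. Types (formulas for $\theta_i,\theta^*_i$ hold for $0\le i\le d$, those for $\varphi_i,\phi_i$ for $1\le i\le d$): $q$-Racah type: there exist nonzero scalars $q,h,h^*,s,s^*,r_1,r_2$ with $r_1r_2=ss^*q^{d+1}$;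 none of $q^i,r_1q^i,r_2q^i,s^*q^i/r_1,s^*q^i/r_2$ equal to $1$ for $1\le i\le d$; $sq^i\ne1$, $s^*q^i\ne1$ for $2\le i\le 2d$; $\theta_i=\theta_0+h(1-q^i)(1-sq^{i+1})q^{-i}$, $\theta^*_i=\theta^*_0+h^*(1-q^i)(1-s^*q^{i+1})q^{-i}$; $\varphi_i=hh^*q^{1-2i}(1-q^i)(1-q^{i-d-1})(1-r_1q^i)(1-r_2q^i)$, $\phi_i=hh^*q^{1-2i}(1-q^i)(1-q^{i-d-1})(r_1-s^*q^i)(r_2-s^*q^i)/s^*$. $q$-Hahn type: there exist nonzero scalars $q,h,h^*,s^*,r$ with none of $q^i,rq^i,s^*q^i/r$ equal to $1$ for $1\le i\le d$; $s^*q^i\ne1$ for $2\le i\le 2d$; $\theta_i=\theta_0+h(1-q^i)q^{-i}$, $\theta^*_i=\theta^*_0+h^*(1-q^i)(1-s^*q^{i+1})q^{-i}$; $\varphi_i=hh^*q^{1-2i}(1-q^i)(1-q^{i-d-1})(1-rq^i)$, $\phi_i=-hh^*q^{1-i}(1-q^i)(1-q^{i-d-1})(r-s^*q^i)$. Dual $q$-Krawtchouk type: there exist nonzero scalars $q,h,h^*,s$ with $q^i\ne1$ for $1\le i\le d$; $sq^i\neq 1$ for $2\le i\le 2d$; $\theta_i=\theta_0+h(1-q^i)(1-sq^{i+1})q^{-i}$, $\theta^*_i=\theta^*_0+h^*(1-q^i)q^{-i}$; $\varphi_i=hh^*q^{1-2i}(1-q^i)(1-q^{i-d-1})$, $\phi_i=hh^*sq^{d+2-2i}(1-q^i)(1-q^{i-d-1})$.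 Racah type: there exist scalars $h,h^*,s,s^*,r_1,r_2$ with $h,h^*$ nonzero; $r_1+r_2=s+s^*+d+1$; $\mathrm{char}\,\mathbb F$ is $0$ or a prime greater than $d$; none of $r_1,r_2,s^*-r_1,s^*-r_2$ equal to $-i$ for $1\le i\le d$; $s\ne-i$, $s^*\ne-i$ for $2\le i\le 2d$; $\theta_i=\theta_0+hi(i+1+s)$, $\theta^*_i=\theta^*_0+h^*i(i+1+s^* )$; $\varphi_i=hh^*i(i-d-1)(i+r_1)(i+r_2)$, $\phi_i=hh^*i(i-d-1)(i+s^*-r_1)(i+s^*-r_2)$. Hahn type: there exist scalars $h^*,s,s^*,r$ with $h^*,s$ nonzero; $\mathrm{char}\,\mathbb F$ is $0$ or a prime greater than $d$; neither of $r,\,s^*-r$ equals $-i$ for $1\le i\le d$; $s^*\ne -i$ for $2\le i\le 2d$; $\theta_i=\theta_0+si$, $\theta^*_i=\theta^*_0+h^*i(i+1+s^* )$; $\varphi_i=h^*si(i-d-1)(i+r)$, $\phi_i=-h^*si(i-d-1)(i+s^*-r)$. Krawtchouk type: there exist nonzero scalars $s,s^*,r$ with $\mathrm{char}\,\mathbb F$ equal to $0$ or a prime greater than $d$; $r\ne ss^*$; $\theta_i=\theta_0+si$, $\theta^*_i=\theta^*_0+s^*i$; $\varphi_i=ri(i-d-1)$, $\phi_i=(r-ss^* )i(i-d-1)$. Bannai/Ito type: there exist scalars $h,h^*,s,s^*,r_1,r_2$ with $h,h^*$ nonzero; $\mathrm{char}\,\mathbb F$ is $0$ or an odd prime greater than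 $d/2$; $r_1+r_2=-s-s^*+d+1$; neither of $r_1,-s^*-r_1$ equal to $-i$ for $1\le i\le d$ with $d-i$ even; neither of $r_2,-s^*-r_2$ equal to $-i$ for $1\le i\le d$ with $i$ odd; neither of $s,s^*$ equal to $2i$ for $1\le i\le d$; $\theta_i=\theta_0+h(s-1+(1-s+2i)(-1)^i)$, $\theta^*_i=\theta^*_0+h^*(s^*-1+(1-s^*+2i)(-1)^i)$; if $d$ is even: $\varphi_i=-4hh^*i(i+r_1)$ and $\phi_i=4hh^*i(i-s^*-r_1)$ for $i$ even, $\varphi_i=-4hh^*(i-d-1)(i+r_2)$ and $\phi_i=4hh^*(i-d-1)(i-s^*-r_2)$ for $i$ odd; if $d$ is odd: $\varphi_i=\phi_i=-4hh^*i(i-d-1)$ for $i$ even, $\varphi_i=-4hh^*(i+r_1)(i+r_2)$ and $\phi_i=-4hh^*(i-s^*-r_1)(i-s^*-r_2)$ for $i$ odd. *)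

theory Defs
  imports
    "HOL-Computational_Algebra.Computational_Algebra"
    "HOL-Library.Function_Algebras"
begin

text \<open>
  A vector space \<open>V\<close> over \<open>'a\<close> is a type \<open>'v\<close> with a scalar multiplication \<open>scale\<close> satisfying
  \<^locale>\<open>vector_space\<close>; endomorphisms are functions satisfying \<^const>\<open>Vector_Spaces.linear\<close>.
  Sums and differences of endomorphisms are pointwise, their product is composition.
  Families indexed by \<open>0, \<dots>, d\<close> are functions on \<^typ>\<open>nat\<close>; values beyond \<open>d\<close> are irrelevant.
\<close>

definition op_scale :: "('a \<Rightarrow> 'v \<Rightarrow> 'v) \<Rightarrow> 'a \<Rightarrow> ('w \<Rightarrow> 'v) \<Rightarrow> ('w \<Rightarrow> 'v)" where
  "op_scale scale c X = (\<lambda>v. scale c (X v))"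

lemma vector_space_op_scale:
  assumes "vector_space scale"
  shows "vector_space (op_scale scale)"
proof -
  interpret vector_space scale by fact
  show ?thesis
    by unfold_locales
      (simp_all add: op_scale_def fun_eq_iff scale_right_distrib scale_left_distrib)
qed

definition is_basis :: "('a::field \<Rightarrow> 'v::ab_group_add \<Rightarrow> 'v) \<Rightarrow> 'v set \<Rightarrow> 'v set \<Rightarrow> bool" where
  "is_basis scale W B \<longleftrightarrow> \<not> module.dependent scale B \<and> module.span scale B = W"

definition ordered_basis :: "('a::field \<Rightarrow> 'v::ab_group_add \<Rightarrow> 'v) \<Rightarrow> nat \<Rightarrow> (nat \<Rightarrow> 'v) \<Rightarrow> bool" where
  "ordered_basis scale d v \<longleftrightarrow> inj_on v {..d} \<and> is_basis scale UNIV (v ` {..d})"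

text \<open>Column \<open>j\<close> of the matrix of \<open>X\<close> holds the coordinates of \<open>X (v j)\<close>.\<close>

definition matrix_wrt ::
  "('a::field \<Rightarrow> 'v::ab_group_add \<Rightarrow> 'v) \<Rightarrow> nat \<Rightarrow> (nat \<Rightarrow> 'v) \<Rightarrow> ('v \<Rightarrow> 'v) \<Rightarrow> nat \<Rightarrow> nat \<Rightarrow> 'a" where
  "matrix_wrt scale d v X i j = module.representation scale (v ` {..d}) (X (v j)) (v i)"

definition trace_op :: "('a::field \<Rightarrow> 'v::ab_group_add \<Rightarrow> 'v) \<Rightarrow> ('v \<Rightarrow> 'v) \<Rightarrow> 'a" where
  "trace_op scale X =
    (let B = (SOME B. is_basis scale UNIV B) in \<Sum>b\<in>B. module.representation scale B (X b) b)"

definition diagonal :: "nat \<Rightarrow> (nat \<Rightarrow> nat \<Rightarrow> 'a::field) \<Rightarrow> bool" where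
  "diagonal d M \<longleftrightarrow> (\<forall>i\<le>d. \<forall>j\<le>d. i \<noteq> j \<longrightarrow> M i j = 0)"

definition irreducible_tridiagonal :: "nat \<Rightarrow> (nat \<Rightarrow> nat \<Rightarrow> 'a::field) \<Rightarrow> bool" where
  "irreducible_tridiagonal d M \<longleftrightarrow>
    (\<forall>i\<le>d. \<forall>j\<le>d. Suc i < j \<or> Suc j < i \<longrightarrow> M i j = 0) \<and>
    (\<forall>i<d. M i (Suc i) \<noteq> 0 \<and> M (Suc i) i \<noteq> 0)"

definition tridiagonal_diagonal_basis ::
  "('a::field \<Rightarrow> 'v::ab_group_add \<Rightarrow> 'v) \<Rightarrow> nat \<Rightarrow> ('v \<Rightarrow> 'v) \<Rightarrow> ('v \<Rightarrow> 'v) \<Rightarrow> (nat \<Rightarrow> 'v) \<Rightarrow> bool" where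
  "tridiagonal_diagonal_basis scale d X Y v \<longleftrightarrow>
    ordered_basis scale d v \<and>
    irreducible_tridiagonal d (matrix_wrt scale d v X) \<and>
    diagonal d (matrix_wrt scale d v Y)"

definition leonard_pair ::
  "('a::field \<Rightarrow> 'v::ab_group_add \<Rightarrow> 'v) \<Rightarrow> nat \<Rightarrow> ('v \<Rightarrow> 'v) \<Rightarrow> ('v \<Rightarrow> 'v) \<Rightarrow> bool" where
  "leonard_pair scale d A As \<longleftrightarrow>
    Vector_Spaces.linear scale scale A \<and> Vector_Spaces.linear scale scale As \<and>
    (\<exists>v. tridiagonal_diagonal_basis scale d A As v) \<and>
    (\<exists>v. tridiagonal_diagonal_basis scale d As A v)"

definition is_eigenvalue ::
  "('a::field \<Rightarrow> 'v::ab_group_add \<Rightarrow> 'v) \<Rightarrow> ('v \<Rightarrow> 'v) \<Rightarrow> 'a \<Rightarrow> bool" where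
  "is_eigenvalue scale X \<theta> \<longleftrightarrow> (\<exists>v. v \<noteq> 0 \<and> X v = scale \<theta> v)"

text \<open>
  For diagonalizable \<open>X\<close> the last two conjuncts determine \<open>P\<close> as the projection onto the
  \<open>\<theta>\<close>-eigenspace along the sum of the other eigenspaces.
\<close>

definition primitive_idempotent ::
  "('a::field \<Rightarrow> 'v::ab_group_add \<Rightarrow> 'v) \<Rightarrow> ('v \<Rightarrow> 'v) \<Rightarrow> 'a \<Rightarrow> ('v \<Rightarrow> 'v) \<Rightarrow> bool" where
  "primitive_idempotent scale X \<theta> P \<longleftrightarrow>
    is_eigenvalue scale X \<theta> \<and> Vector_Spaces.linear scale scale P \<and>
    (\<forall>v. X v = scale \<theta> v \<longrightarrow> P v = v) \<and>
    (\<forall>\<eta> v. \<eta> \<noteq> \<theta> \<and> X v = scale \<eta> v \<longrightarrow> P v = 0)"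

definition eigenvalue_sequence ::
  "('a::field \<Rightarrow> 'v::ab_group_add \<Rightarrow> 'v) \<Rightarrow> nat \<Rightarrow> ('v \<Rightarrow> 'v) \<Rightarrow> (nat \<Rightarrow> 'v \<Rightarrow> 'v) \<Rightarrow> (nat \<Rightarrow> 'a) \<Rightarrow> bool" where
  "eigenvalue_sequence scale d X E \<theta> \<longleftrightarrow> (\<forall>i\<le>d. primitive_idempotent scale X (\<theta> i) (E i))"

definition standard_eigenvalue_ordering ::
  "('a::field \<Rightarrow> 'v::ab_group_add \<Rightarrow> 'v) \<Rightarrow> nat \<Rightarrow> ('v \<Rightarrow> 'v) \<Rightarrow> ('v \<Rightarrow> 'v) \<Rightarrow> (nat \<Rightarrow> 'a) \<Rightarrow> bool" where
  "standard_eigenvalue_ordering scale d X Y \<theta> \<longleftrightarrow>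
    bij_betw \<theta> {..d} {\<eta>. is_eigenvalue scale X \<eta>} \<and>
    (\<exists>v. (\<forall>i\<le>d. X (v i) = scale (\<theta> i) (v i)) \<and> tridiagonal_diagonal_basis scale d Y X v)"

definition standard_idempotent_ordering ::
  "('a::field \<Rightarrow> 'v::ab_group_add \<Rightarrow> 'v) \<Rightarrow> nat \<Rightarrow> ('v \<Rightarrow> 'v) \<Rightarrow> ('v \<Rightarrow> 'v) \<Rightarrow> (nat \<Rightarrow> 'v \<Rightarrow> 'v) \<Rightarrow> bool" where
  "standard_idempotent_ordering scale d X Y E \<longleftrightarrow>
    (\<exists>\<theta>. standard_eigenvalue_ordering scale d X Y \<theta> \<and> eigenvalue_sequence scale d X E \<theta>)"

definition leonard_system ::
  "('a::field \<Rightarrow> 'v::ab_group_add \<Rightarrow> 'v) \<Rightarrow> nat \<Rightarrow> ('v \<Rightarrow> 'v) \<Rightarrow> (nat \<Rightarrow> 'v \<Rightarrow> 'v) \<Rightarrow>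
   ('v \<Rightarrow> 'v) \<Rightarrow> (nat \<Rightarrow> 'v \<Rightarrow> 'v) \<Rightarrow> bool" where
  "leonard_system scale d A E As Es \<longleftrightarrow>
    leonard_pair scale d A As \<and>
    standard_idempotent_ordering scale d A As E \<and>
    standard_idempotent_ordering scale d As A Es"

text \<open>The vector \<open>(A - \<theta>\<^sub>0 I) \<cdots> (A - \<theta>\<^bsub>i-1\<^esub> I) u\<close>.\<close>

definition split_vector ::
  "('a::field \<Rightarrow> 'v::ab_group_add \<Rightarrow> 'v) \<Rightarrow> ('v \<Rightarrow> 'v) \<Rightarrow> (nat \<Rightarrow> 'a) \<Rightarrow> 'v \<Rightarrow> nat \<Rightarrow> 'v" where
  "split_vector scale A \<theta> u i = foldr (\<lambda>j w. A w - scale (\<theta> j) w) [0..<i] u"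

text \<open>
  For a Leonard system the defining equations determine \<open>\<phi> 1, \<dots>, \<phi> d\<close> uniquely, because the
  split vectors form a basis.
\<close>

definition first_split_sequence ::
  "('a::field \<Rightarrow> 'v::ab_group_add \<Rightarrow> 'v) \<Rightarrow> nat \<Rightarrow> ('v \<Rightarrow> 'v) \<Rightarrow> (nat \<Rightarrow> 'v \<Rightarrow> 'v) \<Rightarrow>
   ('v \<Rightarrow> 'v) \<Rightarrow> (nat \<Rightarrow> 'v \<Rightarrow> 'v) \<Rightarrow> (nat \<Rightarrow> 'a) \<Rightarrow> bool" where
  "first_split_sequence scale d A E As Es \<phi> \<longleftrightarrow>
    (\<exists>\<theta> \<theta>s. eigenvalue_sequence scale d A E \<theta> \<and> eigenvalue_sequence scale d As Es \<theta>s \<and>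
      (\<forall>u \<in> range (Es 0) - {0}.
        let U = split_vector scale A \<theta> u in
          As (U 0) = scale (\<theta>s 0) (U 0) \<and>
          (\<forall>i\<in>{1..d}. As (U i) = scale (\<theta>s i) (U i) + scale (\<phi> i) (U (i - 1)))))"

definition second_split_sequence ::
  "('a::field \<Rightarrow> 'v::ab_group_add \<Rightarrow> 'v) \<Rightarrow> nat \<Rightarrow> ('v \<Rightarrow> 'v) \<Rightarrow> (nat \<Rightarrow> 'v \<Rightarrow> 'v) \<Rightarrow>
   ('v \<Rightarrow> 'v) \<Rightarrow> (nat \<Rightarrow> 'v \<Rightarrow> 'v) \<Rightarrow> (nat \<Rightarrow> 'a) \<Rightarrow> bool" where
  "second_split_sequence scale d A E As Es \<phi> \<longleftrightarrow>
    first_split_sequence scale d A (\<lambda>i. E (d - i)) As Es \<phi>"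

definition zero_diagonal_space ::
  "('a::field \<Rightarrow> 'v::ab_group_add \<Rightarrow> 'v) \<Rightarrow> nat \<Rightarrow> ('v \<Rightarrow> 'v) \<Rightarrow> ('v \<Rightarrow> 'v) \<Rightarrow> (nat \<Rightarrow> 'v \<Rightarrow> 'v) \<Rightarrow>
   ('v \<Rightarrow> 'v) set" where
  "zero_diagonal_space scale d A As Es =
    {X \<in> module.span (op_scale scale) {id, As, A, A \<circ> As}. \<forall>i\<le>d. Es i \<circ> X \<circ> Es i = 0}"

text \<open>
  In the type predicates, \<open>\<phi>1\<close> and \<open>\<phi>2\<close> are the first and the second split sequence.
  A suffix \<open>s\<close> marks a starred quantity: \<open>\<theta>s\<close>, \<open>hs\<close>, \<open>ss\<close> stand for \<open>\<theta>\<close>, \<open>h\<close>, \<open>s\<close> with a star.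
\<close>

definition q_racah_type ::
  "nat \<Rightarrow> (nat \<Rightarrow> 'a::field) \<Rightarrow> (nat \<Rightarrow> 'a) \<Rightarrow> (nat \<Rightarrow> 'a) \<Rightarrow> (nat \<Rightarrow> 'a) \<Rightarrow>
   'a \<Rightarrow> 'a \<Rightarrow> 'a \<Rightarrow> 'a \<Rightarrow> 'a \<Rightarrow> 'a \<Rightarrow> 'a \<Rightarrow> bool" where
  "q_racah_type d \<theta> \<theta>s \<phi>1 \<phi>2 q h hs s ss r1 r2 \<longleftrightarrow>
    q \<noteq> 0 \<and> h \<noteq> 0 \<and> hs \<noteq> 0 \<and> s \<noteq> 0 \<and> ss \<noteq> 0 \<and> r1 \<noteq> 0 \<and> r2 \<noteq> 0 \<and>
    r1 * r2 = s * ss * q ^ (d + 1) \<and>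
    (\<forall>i\<in>{1..d}. q ^ i \<noteq> 1 \<and> r1 * q ^ i \<noteq> 1 \<and> r2 * q ^ i \<noteq> 1 \<and>
        ss * q ^ i / r1 \<noteq> 1 \<and> ss * q ^ i / r2 \<noteq> 1) \<and>
    (\<forall>i\<in>{2..2 * d}. s * q ^ i \<noteq> 1 \<and> ss * q ^ i \<noteq> 1) \<and>
    (\<forall>i\<le>d. \<theta> i = \<theta> 0 + h * (1 - q ^ i) * (1 - s * q ^ (i + 1)) * q powi (- int i)) \<and>
    (\<forall>i\<le>d. \<theta>s i = \<theta>s 0 + hs * (1 - q ^ i) * (1 - ss * q ^ (i + 1)) * q powi (- int i)) \<and>
    (\<forall>i\<in>{1..d}. \<phi>1 i = h * hs * q powi (1 - 2 * int i) * (1 - q ^ i) *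
        (1 - q powi (int i - int d - 1)) * (1 - r1 * q ^ i) * (1 - r2 * q ^ i)) \<and>
    (\<forall>i\<in>{1..d}. \<phi>2 i = h * hs * q powi (1 - 2 * int i) * (1 - q ^ i) *
        (1 - q powi (int i - int d - 1)) * (r1 - ss * q ^ i) * (r2 - ss * q ^ i) / ss)"

definition q_hahn_type ::
  "nat \<Rightarrow> (nat \<Rightarrow> 'a::field) \<Rightarrow> (nat \<Rightarrow> 'a) \<Rightarrow> (nat \<Rightarrow> 'a) \<Rightarrow> (nat \<Rightarrow> 'a) \<Rightarrow>
   'a \<Rightarrow> 'a \<Rightarrow> 'a \<Rightarrow> 'a \<Rightarrow> 'a \<Rightarrow> bool" where
  "q_hahn_type d \<theta> \<theta>s \<phi>1 \<phi>2 q h hs ss r \<longleftrightarrow>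
    q \<noteq> 0 \<and> h \<noteq> 0 \<and> hs \<noteq> 0 \<and> ss \<noteq> 0 \<and> r \<noteq> 0 \<and>
    (\<forall>i\<in>{1..d}. q ^ i \<noteq> 1 \<and> r * q ^ i \<noteq> 1 \<and> ss * q ^ i / r \<noteq> 1) \<and>
    (\<forall>i\<in>{2..2 * d}. ss * q ^ i \<noteq> 1) \<and>
    (\<forall>i\<le>d. \<theta> i = \<theta> 0 + h * (1 - q ^ i) * q powi (- int i)) \<and>
    (\<forall>i\<le>d. \<theta>s i = \<theta>s 0 + hs * (1 - q ^ i) * (1 - ss * q ^ (i + 1)) * q powi (- int i)) \<and>
    (\<forall>i\<in>{1..d}. \<phi>1 i = h * hs * q powi (1 - 2 * int i) * (1 - q ^ i) *
        (1 - q powi (int i - int d - 1)) * (1 - r * q ^ i)) \<and>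
    (\<forall>i\<in>{1..d}. \<phi>2 i = - h * hs * q powi (1 - int i) * (1 - q ^ i) *
        (1 - q powi (int i - int d - 1)) * (r - ss * q ^ i))"

definition dual_q_krawtchouk_type ::
  "nat \<Rightarrow> (nat \<Rightarrow> 'a::field) \<Rightarrow> (nat \<Rightarrow> 'a) \<Rightarrow> (nat \<Rightarrow> 'a) \<Rightarrow> (nat \<Rightarrow> 'a) \<Rightarrow>
   'a \<Rightarrow> 'a \<Rightarrow> 'a \<Rightarrow> 'a \<Rightarrow> bool" where
  "dual_q_krawtchouk_type d \<theta> \<theta>s \<phi>1 \<phi>2 q h hs s \<longleftrightarrow>
    q \<noteq> 0 \<and> h \<noteq> 0 \<and> hs \<noteq> 0 \<and> s \<noteq> 0 \<and>
    (\<forall>i\<in>{1..d}. q ^ i \<noteq> 1) \<and>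
    (\<forall>i\<in>{2..2 * d}. s * q ^ i \<noteq> 1) \<and>
    (\<forall>i\<le>d. \<theta> i = \<theta> 0 + h * (1 - q ^ i) * (1 - s * q ^ (i + 1)) * q powi (- int i)) \<and>
    (\<forall>i\<le>d. \<theta>s i = \<theta>s 0 + hs * (1 - q ^ i) * q powi (- int i)) \<and>
    (\<forall>i\<in>{1..d}. \<phi>1 i = h * hs * q powi (1 - 2 * int i) * (1 - q ^ i) *
        (1 - q powi (int i - int d - 1))) \<and>
    (\<forall>i\<in>{1..d}. \<phi>2 i = h * hs * s * q powi (int d + 2 - 2 * int i) * (1 - q ^ i) *
        (1 - q powi (int i - int d - 1)))"

definition racah_type ::
  "nat \<Rightarrow> (nat \<Rightarrow> 'a::field) \<Rightarrow> (nat \<Rightarrow> 'a) \<Rightarrow> (nat \<Rightarrow> 'a) \<Rightarrow> (nat \<Rightarrow> 'a) \<Rightarrow>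
   'a \<Rightarrow> 'a \<Rightarrow> 'a \<Rightarrow> 'a \<Rightarrow> 'a \<Rightarrow> 'a \<Rightarrow> bool" where
  "racah_type d \<theta> \<theta>s \<phi>1 \<phi>2 h hs s ss r1 r2 \<longleftrightarrow>
    h \<noteq> 0 \<and> hs \<noteq> 0 \<and>
    r1 + r2 = s + ss + of_nat d + 1 \<and>
    (CHAR('a) = 0 \<or> prime CHAR('a) \<and> d < CHAR('a)) \<and>
    (\<forall>i\<in>{1..d}. r1 \<noteq> - of_nat i \<and> r2 \<noteq> - of_nat i \<and>
        ss - r1 \<noteq> - of_nat i \<and> ss - r2 \<noteq> - of_nat i) \<and>
    (\<forall>i\<in>{2..2 * d}. s \<noteq> - of_nat i \<and> ss \<noteq> - of_nat i) \<and>
    (\<forall>i\<le>d. \<theta> i = \<theta> 0 + h * of_nat i * (of_nat i + 1 + s)) \<and>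
    (\<forall>i\<le>d. \<theta>s i = \<theta>s 0 + hs * of_nat i * (of_nat i + 1 + ss)) \<and>
    (\<forall>i\<in>{1..d}. \<phi>1 i = h * hs * of_nat i * (of_nat i - of_nat d - 1) *
        (of_nat i + r1) * (of_nat i + r2)) \<and>
    (\<forall>i\<in>{1..d}. \<phi>2 i = h * hs * of_nat i * (of_nat i - of_nat d - 1) *
        (of_nat i + ss - r1) * (of_nat i + ss - r2))"

definition hahn_type ::
  "nat \<Rightarrow> (nat \<Rightarrow> 'a::field) \<Rightarrow> (nat \<Rightarrow> 'a) \<Rightarrow> (nat \<Rightarrow> 'a) \<Rightarrow> (nat \<Rightarrow> 'a) \<Rightarrow>
   'a \<Rightarrow> 'a \<Rightarrow> 'a \<Rightarrow> 'a \<Rightarrow> bool" where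
  "hahn_type d \<theta> \<theta>s \<phi>1 \<phi>2 hs s ss r \<longleftrightarrow>
    hs \<noteq> 0 \<and> s \<noteq> 0 \<and>
    (CHAR('a) = 0 \<or> prime CHAR('a) \<and> d < CHAR('a)) \<and>
    (\<forall>i\<in>{1..d}. r \<noteq> - of_nat i \<and> ss - r \<noteq> - of_nat i) \<and>
    (\<forall>i\<in>{2..2 * d}. ss \<noteq> - of_nat i) \<and>
    (\<forall>i\<le>d. \<theta> i = \<theta> 0 + s * of_nat i) \<and>
    (\<forall>i\<le>d. \<theta>s i = \<theta>s 0 + hs * of_nat i * (of_nat i + 1 + ss)) \<and>
    (\<forall>i\<in>{1..d}. \<phi>1 i = hs * s * of_nat i * (of_nat i - of_nat d - 1) * (of_nat i + r)) \<and>
    (\<forall>i\<in>{1..d}. \<phi>2 i = - hs * s * of_nat i * (of_nat i - of_nat d - 1) * (of_nat i + ss - r))"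

definition krawtchouk_type ::
  "nat \<Rightarrow> (nat \<Rightarrow> 'a::field) \<Rightarrow> (nat \<Rightarrow> 'a) \<Rightarrow> (nat \<Rightarrow> 'a) \<Rightarrow> (nat \<Rightarrow> 'a) \<Rightarrow>
   'a \<Rightarrow> 'a \<Rightarrow> 'a \<Rightarrow> bool" where
  "krawtchouk_type d \<theta> \<theta>s \<phi>1 \<phi>2 s ss r \<longleftrightarrow>
    s \<noteq> 0 \<and> ss \<noteq> 0 \<and> r \<noteq> 0 \<and>
    (CHAR('a) = 0 \<or> prime CHAR('a) \<and> d < CHAR('a)) \<and>
    r \<noteq> s * ss \<and>
    (\<forall>i\<le>d. \<theta> i = \<theta> 0 + s * of_nat i) \<and>
    (\<forall>i\<le>d. \<theta>s i = \<theta>s 0 + ss * of_nat i) \<and>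
    (\<forall>i\<in>{1..d}. \<phi>1 i = r * of_nat i * (of_nat i - of_nat d - 1)) \<and>
    (\<forall>i\<in>{1..d}. \<phi>2 i = (r - s * ss) * of_nat i * (of_nat i - of_nat d - 1))"

definition bannai_ito_type ::
  "nat \<Rightarrow> (nat \<Rightarrow> 'a::field) \<Rightarrow> (nat \<Rightarrow> 'a) \<Rightarrow> (nat \<Rightarrow> 'a) \<Rightarrow> (nat \<Rightarrow> 'a) \<Rightarrow>
   'a \<Rightarrow> 'a \<Rightarrow> 'a \<Rightarrow> 'a \<Rightarrow> 'a \<Rightarrow> 'a \<Rightarrow> bool" where
  "bannai_ito_type d \<theta> \<theta>s \<phi>1 \<phi>2 h hs s ss r1 r2 \<longleftrightarrow>
    h \<noteq> 0 \<and> hs \<noteq> 0 \<and>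
    (CHAR('a) = 0 \<or> prime CHAR('a) \<and> odd CHAR('a) \<and> d < 2 * CHAR('a)) \<and>
    r1 + r2 = - s - ss + of_nat d + 1 \<and>
    (\<forall>i\<in>{1..d}. even (d - i) \<longrightarrow> r1 \<noteq> - of_nat i \<and> - ss - r1 \<noteq> - of_nat i) \<and>
    (\<forall>i\<in>{1..d}. odd i \<longrightarrow> r2 \<noteq> - of_nat i \<and> - ss - r2 \<noteq> - of_nat i) \<and>
    (\<forall>i\<in>{1..d}. s \<noteq> 2 * of_nat i \<and> ss \<noteq> 2 * of_nat i) \<and>
    (\<forall>i\<le>d. \<theta> i = \<theta> 0 + h * (s - 1 + (1 - s + 2 * of_nat i) * (- 1) ^ i)) \<and>
    (\<forall>i\<le>d. \<theta>s i = \<theta>s 0 + hs * (ss - 1 + (1 - ss + 2 * of_nat i) * (- 1) ^ i)) \<and>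
    (even d \<longrightarrow>
      (\<forall>i\<in>{1..d}. even i \<longrightarrow>
        \<phi>1 i = - 4 * h * hs * of_nat i * (of_nat i + r1) \<and>
        \<phi>2 i = 4 * h * hs * of_nat i * (of_nat i - ss - r1)) \<and>
      (\<forall>i\<in>{1..d}. odd i \<longrightarrow>
        \<phi>1 i = - 4 * h * hs * (of_nat i - of_nat d - 1) * (of_nat i + r2) \<and>
        \<phi>2 i = 4 * h * hs * (of_nat i - of_nat d - 1) * (of_nat i - ss - r2))) \<and>
    (odd d \<longrightarrow>
      (\<forall>i\<in>{1..d}. even i \<longrightarrow>
        \<phi>1 i = - 4 * h * hs * of_nat i * (of_nat i - of_nat d - 1) \<and>
        \<phi>2 i = - 4 * h * hs * of_nat i * (of_nat i - of_nat d - 1)) \<and>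
      (\<forall>i\<in>{1..d}. odd i \<longrightarrow>
        \<phi>1 i = - 4 * h * hs * (of_nat i + r1) * (of_nat i + r2) \<and>
        \<phi>2 i = - 4 * h * hs * (of_nat i - ss - r1) * (of_nat i - ss - r2)))"

end

theory Submission
  imports Defs
begin

text \<open>
  On \<open>E\<^sup>*\<^sub>i V\<close> the operator \<open>A\<^sup>*\<close> acts as \<open>\<theta>\<^sup>*\<^sub>i\<close> and the compression of \<open>A\<close> is \<open>a\<^sub>i\<close>, so
  \<open>c X\<^sup>- - c' X\<^sup>+\<close> has zero diagonal iff
  \<open>c (a\<^sub>i - a\<^sub>0) (\<theta>\<^sup>*\<^sub>i - \<theta>\<^sup>*\<^sub>d) = c' (a\<^sub>i - a\<^sub>d) (\<theta>\<^sup>*\<^sub>i - \<theta>\<^sup>*\<^sub>0)\<close> for all \<open>i\<close>.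
  Expressing \<open>a\<^sub>i\<close> by the parameter array, one finds in each type that \<open>a\<^sub>i\<close> is a
  fractional linear function of \<open>\<theta>\<^sup>*\<^sub>i\<close>, which is what this identity says.
  The element is nonzero as soon as \<open>(c, c') \<noteq> (0, 0)\<close>: applied to \<open>E\<^sup>*\<^sub>0 V\<close> only \<open>X\<^sup>-\<close>
  survives, applied to \<open>E\<^sup>*\<^sub>d V\<close> only \<open>X\<^sup>+\<close>, and \<open>A\<close> is irreducible tridiagonal.
\<close>

section \<open>Diagonal entries in terms of the parameter array\<close>

text \<open>The conditions tying \<open>ss\<close> to \<open>r1\<close>, \<open>r2\<close> or
  \<open>r\<close> make \<open>\<theta>s i - \<theta>s (i - 1)\<close> and \<open>\<phi>1 i\<close>
  share a linear factor (for Bannai/Ito only for one parity of \<open>i\<close>). After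
  cancellation, \<open>a i - a 0\<close> and \<open>a i - a d\<close> factor completely: for
  \<open>0 < i < d\<close> they are, up to a common factor depending on \<open>i\<close>, constants
  times \<open>\<theta>s i - \<theta>s 0\<close> and \<open>\<theta>s i - \<theta>s d\<close>. The
  weights are these constants, exchanged and cleared of denominators and common scalars; this is
  where their odd-looking values come from. Two obstacles remain. The formulas are rational, so
  every denominator must be nonzero; powers of \<open>q\<close> aside, the denominators come from
  factors of differences of consecutive dual eigenvalues, so the distinctness of these suffices. And
  a single weight may vanish for admissible parameters; that both never vanish together has to be
  extracted, where it is not obvious, from the excluded parameter values and the
  characteristic.\<close>

definition split_diagonal ::
  "nat \<Rightarrow> (nat \<Rightarrow> 'a::field) \<Rightarrow> (nat \<Rightarrow> 'a) \<Rightarrow> (nat \<Rightarrow> 'a) \<Rightarrow> nat \<Rightarrow> 'a" where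
  "split_diagonal d \<theta> \<theta>s \<phi> i =
    \<theta> i + (if i = 0 then 0 else \<phi> i / (\<theta>s i - \<theta>s (i - 1))) +
      (if i = d then 0 else \<phi> (i + 1) / (\<theta>s i - \<theta>s (i + 1)))"

text \<open>The quotient of \<open>\<phi> i\<close> enters entries \<open>i\<close> and
  \<open>i - 1\<close> with opposite signs, because the two denominators are opposite. Hence one
  closed form \<open>X\<close> of this quotient determines the whole diagonal; at \<open>0\<close>
  and \<open>d\<close> one neighbour is missing.\<close>

lemma split_diagonal_eq:
  assumes "d > 0" and X: "\<forall>i\<in>{1..d}. \<phi> i / (\<theta>s i - \<theta>s (i - 1)) = X i"
  shows "split_diagonal d \<theta> \<theta>s \<phi> 0 = \<theta> 0 - X 1"
    and "split_diagonal d \<theta> \<theta>s \<phi> d = \<theta> d + X d"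
    and "\<And>i. 0 < i \<Longrightarrow> i < d \<Longrightarrow> split_diagonal d \<theta> \<theta>s \<phi> i = \<theta> i + X i - X (i + 1)"
proof -
  have up: "\<phi> (i + 1) / (\<theta>s i - \<theta>s (i + 1)) = - X (i + 1)" if "i < d" for i
  proof -
    have "\<phi> (i + 1) / (\<theta>s i - \<theta>s (i + 1)) = - (\<phi> (i + 1) / (\<theta>s (i + 1) - \<theta>s i))"
      by (metis minus_diff_eq minus_divide_right)
    then show ?thesis using bspec[OF X, of "i + 1"] that by simp
  qed
  show "split_diagonal d \<theta> \<theta>s \<phi> 0 = \<theta> 0 - X 1"
    and "split_diagonal d \<theta> \<theta>s \<phi> d = \<theta> d + X d"
    and "\<And>i. 0 < i \<Longrightarrow> i < d \<Longrightarrow> split_diagonal d \<theta> \<theta>s \<phi> i = \<theta> i + X i - X (i + 1)"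
    using X up up[of 0] assms(1) by (simp_all add: split_diagonal_def)
qed

definition balanced_weights ::
  "nat \<Rightarrow> (nat \<Rightarrow> 'a::field) \<Rightarrow> (nat \<Rightarrow> 'a) \<Rightarrow> 'a \<Rightarrow> 'a \<Rightarrow> bool" where
  "balanced_weights d \<theta>s a cm cp \<longleftrightarrow>
    (\<forall>i\<le>d. cm * (a i - a 0) * (\<theta>s i - \<theta>s d) = cp * (a i - a d) * (\<theta>s i - \<theta>s 0))"

text \<open>At \<open>i = 0\<close> and \<open>i = d\<close> each side contains a vanishing
  difference, so closed forms are needed only for the inner entries.\<close>

lemma balanced_weightsI:
  assumes "\<And>i. 0 < i \<Longrightarrow> i < d \<Longrightarrow>
    cm * (a i - a 0) * (\<theta>s i - \<theta>s d) = cp * (a i - a d) * (\<theta>s i - \<theta>s 0)"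
  shows "balanced_weights d \<theta>s a cm cp"
  unfolding balanced_weights_def
proof (intro allI impI)
  fix i assume "i \<le> d"
  then consider "i = 0" | "i = d" | "0 < i" "i < d" by linarith
  then show "cm * (a i - a 0) * (\<theta>s i - \<theta>s d) = cp * (a i - a d) * (\<theta>s i - \<theta>s 0)"
    using assms by cases auto
qed

section \<open>Coordinates with respect to an ordered basis\<close>

definition coord ::
  "('a::field \<Rightarrow> 'v::ab_group_add \<Rightarrow> 'v) \<Rightarrow> nat \<Rightarrow> (nat \<Rightarrow> 'v) \<Rightarrow> nat \<Rightarrow> 'v \<Rightarrow> 'a" where
  "coord scale d v i x = module.representation scale (v ` {..d}) x (v i)"

context vector_space
begin

context
  fixes d :: nat and v :: "nat \<Rightarrow> 'b"
  assumes basis: "ordered_basis scale d v"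
begin

lemma coord_basis: "i \<le> d \<Longrightarrow> j \<le> d \<Longrightarrow> coord scale d v i (v j) = (if i = j then 1 else 0)"
  using basis
  by (auto simp: coord_def ordered_basis_def is_basis_def representation_basis dest: inj_onD)

lemma coord_add: "coord scale d v i (x + y) = coord scale d v i x + coord scale d v i y"
  and coord_diff: "coord scale d v i (x - y) = coord scale d v i x - coord scale d v i y"
  and coord_scale: "coord scale d v i (scale c x) = c * coord scale d v i x"
  using basis
  by (simp_all add: coord_def ordered_basis_def is_basis_def representation_add
      representation_diff representation_scale)

lemma coord_zero: "coord scale d v i 0 = 0"
  by (simp add: coord_def representation_zero)

lemma coord_sum: "coord scale d v i (sum f S) = (\<Sum>s\<in>S. coord scale d v i (f s))"
  by (induction S rule: infinite_finite_induct) (simp_all add: coord_zero coord_add)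

lemma coord_expansion: "(\<Sum>i\<le>d. scale (coord scale d v i x) (v i)) = x"
proof -
  have "(\<Sum>b\<in>v ` {..d}. scale (representation (v ` {..d}) x b) b) = x"
    using basis by (intro sum_representation_eq) (auto simp: ordered_basis_def is_basis_def)
  then show ?thesis
    using basis by (simp add: coord_def ordered_basis_def sum.reindex)
qed

lemma coord_eq_zeroI: "(\<And>i. i \<le> d \<Longrightarrow> coord scale d v i x = 0) \<Longrightarrow> x = 0"
  using coord_expansion[of x] by simp

lemma coord_linear:
  assumes "Vector_Spaces.linear scale scale X"
  shows "coord scale d v i (X x) = (\<Sum>k\<le>d. coord scale d v i (X (v k)) * coord scale d v k x)"
proof -
  interpret X: Vector_Spaces.linear scale scale X by fact
  have "X x = (\<Sum>k\<le>d. scale (coord scale d v k x) (X (v k)))"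
    by (subst (1) coord_expansion[symmetric, of x]) (simp add: X.sum X.scale)
  then show ?thesis by (simp add: coord_sum coord_scale mult.commute)
qed

lemma coord_eigenbasis:
  assumes "Vector_Spaces.linear scale scale X" and "\<And>i. i \<le> d \<Longrightarrow> X (v i) = scale (\<eta> i) (v i)"
    and "i \<le> d"
  shows "coord scale d v i (X x) = \<eta> i * coord scale d v i x"
proof -
  have "coord scale d v i (X (v k)) * coord scale d v k x = (if k = i then \<eta> i * coord scale d v i x else 0)"
    if "k \<le> d" for k
    using that assms by (simp add: coord_scale coord_basis)
  then show ?thesis using assms(3) by (simp add: coord_linear[OF assms(1), of i x])
qed

lemma linear_eq_on_ordered_basis:
  assumes "Vector_Spaces.linear scale scale X" "Vector_Spaces.linear scale scale Y"
    and "\<And>i. i \<le> d \<Longrightarrow> X (v i) = Y (v i)"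
  shows "X = Y"
proof
  fix x
  have "coord scale d v i (X x) = coord scale d v i (Y x)" for i
    using assms by (simp add: coord_linear[of _ i x])
  then show "X x = Y x"
    using coord_eq_zeroI[of "X x - Y x"] by (simp add: coord_diff)
qed

text \<open>Injectivity of \<open>\<eta>\<close> makes every \<open>v j\<close> with
  \<open>j \<noteq> i\<close> an eigenvector for another eigenvalue. So \<open>P\<close> fixes
  \<open>v i\<close> and kills the other basis vectors, which determines it.\<close>

lemma primitive_idempotent_coord:
  assumes "\<And>j. j \<le> d \<Longrightarrow> X (v j) = scale (\<eta> j) (v j)" and "inj_on \<eta> {..d}" and "i \<le> d"
    and P: "primitive_idempotent scale X (\<eta> i) P"
  shows "P x = scale (coord scale d v i x) (v i)"
proof -
  have lin: "Vector_Spaces.linear scale scale (\<lambda>x. scale (coord scale d v i x) (v i))"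
    by unfold_locales (simp_all add: coord_add coord_scale scale_left_distrib scale_right_distrib)
  have "P = (\<lambda>x. scale (coord scale d v i x) (v i))"
  proof (rule linear_eq_on_ordered_basis)
    fix j assume "j \<le> d"
    then have "\<eta> j \<noteq> \<eta> i" if "j \<noteq> i"
      using assms(2,3) that by (auto dest: inj_onD)
    then show "P (v j) = scale (coord scale d v i (v j)) (v i)"
      using assms(1)[OF \<open>j \<le> d\<close>] \<open>j \<le> d\<close> P \<open>i \<le> d\<close> unfolding primitive_idempotent_def
      by (cases "j = i") (auto simp: coord_basis)
  qed (use P lin in \<open>auto simp: primitive_idempotent_def\<close>)
  then show ?thesis by simp
qed

text \<open>\<open>trace_op\<close> uses an arbitrarily chosen basis \<open>B\<close>. Since
  \<open>P \<circ> A\<close> has rank at most one, its trace over \<open>B\<close> is a sum of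
  products that linearity contracts to the value of one functional at \<open>v i\<close>; this
  avoids proving basis invariance of the trace in general.\<close>

lemma trace_rank_one:
  assumes A: "Vector_Spaces.linear scale scale A"
    and P: "\<And>x. P x = scale (coord scale d v i x) (v i)"
  shows "trace_op scale (P \<circ> A) = coord scale d v i (A (v i))"
proof -
  interpret A: Vector_Spaces.linear scale scale A by fact
  define B where "B = (SOME B. is_basis scale UNIV B)"
  have B: "is_basis scale UNIV B"
    unfolding B_def by (rule someI[of _ "v ` {..d}"]) (use basis in \<open>simp add: ordered_basis_def\<close>)
  have ind: "independent B" "span B = UNIV" using B by (auto simp: is_basis_def)
  have "finite B"
    using independent_span_bound[of "v ` {..d}" B] ind basis
    by (auto simp: ordered_basis_def is_basis_def)
  have "trace_op scale (P \<circ> A) = (\<Sum>b\<in>B. coord scale d v i (A b) * representation B (v i) b)"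
    using ind by (simp add: trace_op_def B_def[symmetric] P representation_scale)
  also have "\<dots> = coord scale d v i (A (\<Sum>b\<in>B. scale (representation B (v i) b) b))"
    by (simp add: A.sum A.scale coord_sum coord_scale mult.commute)
  also have "(\<Sum>b\<in>B. scale (representation B (v i) b) b) = v i"
    using ind \<open>finite B\<close> by (intro sum_representation_eq) auto
  finally show ?thesis .
qed

end

text \<open>
  Compare the coordinates of \<open>A (U i)\<close> at \<open>v i\<close> computed in the two bases: the matrix
  \<open>G k j\<close> of \<open>U\<close> with respect to \<open>v\<close> is upper triangular, and its two central diagonals determine
  one another through the eigenvalue equation for \<open>As\<close>.
\<close>

lemma tridiagonal_coord_eq_split_diagonal:
  assumes basis: "ordered_basis scale d v"
    and A: "Vector_Spaces.linear scale scale A" "irreducible_tridiagonal d (matrix_wrt scale d v A)"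
    and As: "Vector_Spaces.linear scale scale As" "\<And>i. i \<le> d \<Longrightarrow> As (v i) = scale (\<theta>s i) (v i)"
    and inj: "inj_on \<theta>s {..d}"
    and U0: "U 0 \<noteq> 0" "As (U 0) = scale (\<theta>s 0) (U 0)"
    and AU: "\<And>j. j < d \<Longrightarrow> A (U j) = U (Suc j) + scale (\<theta> j) (U j)" "A (U d) = scale (\<theta> d) (U d)"
    and AsU: "\<And>j. j \<in> {1..d} \<Longrightarrow> As (U j) = scale (\<theta>s j) (U j) + scale (\<phi> j) (U (j - 1))"
    and "i \<le> d"
  shows "coord scale d v i (A (v i)) = split_diagonal d \<theta> \<theta>s \<phi> i"
proof -
  note coords = coord_add[OF basis] coord_diff[OF basis] coord_scale[OF basis]
  define G where "G k j = coord scale d v k (U j)" for k j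
  define M where "M k j = coord scale d v k (A (v j))" for k j
  have M_zero: "M k j = 0" if "k \<le> d" "j \<le> d" "Suc k < j \<or> Suc j < k" for k j
    using A(2) that unfolding irreducible_tridiagonal_def matrix_wrt_def M_def coord_def by auto
  have M_nz: "M (Suc k) k \<noteq> 0" if "k < d" for k
    using A(2) that unfolding irreducible_tridiagonal_def matrix_wrt_def M_def coord_def by auto
  have \<theta>s_neq: "\<theta>s k \<noteq> \<theta>s j" if "k \<noteq> j" "k \<le> d" "j \<le> d" for k j
    using inj that by (auto dest: inj_onD)
  have G_rec: "(\<theta>s k - \<theta>s j) * G k j = \<phi> j * G k (j - 1)" if "k \<le> d" "j \<in> {1..d}" for k j
    using arg_cong[OF AsU[OF that(2)], of "coord scale d v k"] coord_eigenbasis[OF basis As that(1), of "U j"]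
    by (simp add: coords G_def algebra_simps)
  have G_upper: "G k j = 0" if "j < k" "k \<le> d" for k j
    using that
  proof (induction j)
    case 0
    have "(\<theta>s k - \<theta>s 0) * G k 0 = 0"
      using arg_cong[OF U0(2), of "coord scale d v k"] coord_eigenbasis[OF basis As 0(2), of "U 0"]
      by (simp add: coords G_def algebra_simps)
    then show ?case using \<theta>s_neq[of k 0] 0 by simp
  next
    case (Suc j)
    then show ?case using G_rec[of k "Suc j"] \<theta>s_neq[of k "Suc j"] by simp
  qed
  have MG: "coord scale d v k (A (U j)) = (\<Sum>l\<le>d. M k l * G l j)" for k j
    unfolding M_def G_def by (rule coord_linear[OF basis A(1)])
  \<comment> \<open>Both sides are the coordinate of \<open>A (U j)\<close> at
    \<open>v (Suc j)\<close>: the split recursion gives the left one. For the right one,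
    \<open>U j\<close> has no coordinates beyond \<open>j\<close>, and among the columns up to
    \<open>j\<close> only column \<open>j\<close> of \<open>A\<close> reaches row
    \<open>Suc j\<close>.\<close>
  have G_diag: "G (Suc j) (Suc j) = M (Suc j) j * G j j" if "j < d" for j
  proof -
    have "G (Suc j) (Suc j) = coord scale d v (Suc j) (A (U j))"
      using AU(1)[OF that] G_upper[of j "Suc j"] that by (simp add: coords G_def)
    also have "\<dots> = (\<Sum>l\<le>d. if l = j then M (Suc j) j * G j j else 0)"
      unfolding MG
    proof (intro sum.cong refl)
      fix l assume "l \<in> {..d}"
      then consider "l = j" | "l < j" | "j < l" "l \<le> d" by fastforce
      then show "M (Suc j) l * G l j = (if l = j then M (Suc j) j * G j j else 0)"
        using that G_upper[of j l] M_zero[of "Suc j" l] by cases auto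
    qed
    also have "\<dots> = M (Suc j) j * G j j" using that by simp
    finally show ?thesis .
  qed
  have G00: "G 0 0 \<noteq> 0"
  proof
    assume "G 0 0 = 0"
    then have "coord scale d v k (U 0) = 0" if "k \<le> d" for k
      using G_upper[of 0 k] that by (cases "k = 0") (auto simp: G_def)
    then show False using coord_eq_zeroI[OF basis] U0(1) by blast
  qed
  have G_nz: "G j j \<noteq> 0" if "j \<le> d" for j
    using that
  proof (induction j)
    case 0
    show ?case by (rule G00)
  next
    case (Suc j)
    then show ?case using G_diag[of j] M_nz[of j] by simp
  qed
  \<comment> \<open>In row \<open>i\<close> only the columns \<open>i - 1\<close> and
    \<open>i\<close> contribute, since \<open>U i\<close> has no coordinate beyond \<open>i\<close>.
    For \<open>i = 0\<close> truncated subtraction makes these columns coincide, and the value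
    \<open>0\<close> prevents counting one twice.\<close>
  define below where "below = (if i = 0 then 0 else M i (i - 1) * G (i - 1) i)"
  have "coord scale d v i (A (U i)) = (\<Sum>l\<le>d. (if l = i then M i i * G i i else 0) +
      (if l = i - 1 then below else 0))"
    unfolding MG
  proof (intro sum.cong refl)
    fix l assume "l \<in> {..d}"
    then consider "l = i" | "l < i" "l = i - 1" | "Suc l < i" | "i < l" "l \<le> d" by fastforce
    then show "M i l * G l i = (if l = i then M i i * G i i else 0) + (if l = i - 1 then below else 0)"
      using \<open>i \<le> d\<close> G_upper[of i l] M_zero[of i l] by cases (auto simp: below_def)
  qed
  also have "\<dots> = M i i * G i i + below"
    using \<open>i \<le> d\<close> by (simp add: sum.distrib)
  finally have lhs: "coord scale d v i (A (U i)) = M i i * G i i + below" .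
  \<comment> \<open>The unknown subdiagonal entry of \<open>A\<close> disappears here:
    \<open>G_diag\<close> expresses it as a ratio of diagonal entries of \<open>G\<close>, while
    \<open>G_rec\<close> expresses \<open>G (i - 1) i\<close> through
    \<open>G (i - 1) (i - 1)\<close>, which then cancels.\<close>
  have below: "below = - (if i = 0 then 0 else \<phi> i / (\<theta>s i - \<theta>s (i - 1))) * G i i"
  proof (cases i)
    case 0
    then show ?thesis by (simp add: below_def)
  next
    case (Suc j)
    then have "(\<theta>s j - \<theta>s i) * G j i = \<phi> i * G j j" "\<theta>s j \<noteq> \<theta>s i" "G i i = M i j * G j j"
      using G_rec[of j i] \<theta>s_neq[of j i] G_diag[of j] \<open>i \<le> d\<close> by auto
    then have "(\<theta>s j - \<theta>s i) * below = \<phi> i * G i i"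
      using Suc by (simp add: below_def)
    moreover have "\<theta>s j - \<theta>s i = - (\<theta>s i - \<theta>s j)" "\<theta>s i - \<theta>s j \<noteq> 0"
      using \<open>\<theta>s j \<noteq> \<theta>s i\<close> by auto
    ultimately show ?thesis using Suc by (simp add: field_simps)
  qed
  have above: "coord scale d v i (A (U i)) =
      (if i = d then 0 else \<phi> (i + 1) / (\<theta>s i - \<theta>s (i + 1))) * G i i + \<theta> i * G i i"
  proof (cases "i = d")
    case True
    then show ?thesis using AU(2) by (simp add: coords G_def)
  next
    case False
    then have "(\<theta>s i - \<theta>s (Suc i)) * G i (Suc i) = \<phi> (Suc i) * G i i" "\<theta>s i \<noteq> \<theta>s (Suc i)"
      using G_rec[of i "Suc i"] \<theta>s_neq[of i "Suc i"] \<open>i \<le> d\<close> by auto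
    then have "G i (Suc i) = \<phi> (Suc i) / (\<theta>s i - \<theta>s (Suc i)) * G i i" by (simp add: field_simps)
    then show ?thesis using AU(1)[of i] False \<open>i \<le> d\<close> by (simp add: coords G_def)
  qed
  have "M i i * G i i = split_diagonal d \<theta> \<theta>s \<phi> i * G i i"
    using lhs below above unfolding split_diagonal_def by (simp add: algebra_simps)
  then show ?thesis using G_nz[OF \<open>i \<le> d\<close>] by (simp add: M_def)
qed

text \<open>\<open>foldr\<close> puts the factor with the largest index innermost. It can be pulled
  to the outside because all factors are polynomials in \<open>A\<close> and so commute.\<close>

lemma split_vector_Suc:
  assumes "Vector_Spaces.linear scale scale A"
  shows "split_vector scale A \<theta> u (Suc j) = A (split_vector scale A \<theta> u j) - scale (\<theta> j) (split_vector scale A \<theta> u j)"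
proof -
  interpret A: Vector_Spaces.linear scale scale A by fact
  have comm: "foldr (\<lambda>j w. A w - scale (\<theta> j) w) js (A w - scale c w) =
      A (foldr (\<lambda>j w. A w - scale (\<theta> j) w) js w) - scale c (foldr (\<lambda>j w. A w - scale (\<theta> j) w) js w)" for js w c
    by (induction js) (simp_all add: A.diff A.scale scale_right_diff_distrib mult.commute)
  show ?thesis by (simp add: split_vector_def comm)
qed

text \<open>In an eigenbasis of \<open>A\<close> the factor with index \<open>j\<close> kills the
  coordinate at \<open>w j\<close>, so nothing survives all \<open>d + 1\<close> factors. This makes
  the last split vector an eigenvector of \<open>A\<close>.\<close>

lemma split_vector_eq_zero:
  assumes A: "Vector_Spaces.linear scale scale A"
    and w: "ordered_basis scale d w" "\<And>i. i \<le> d \<Longrightarrow> A (w i) = scale (\<theta> i) (w i)"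
  shows "split_vector scale A \<theta> u (Suc d) = 0"
proof (rule coord_eq_zeroI[OF w(1)])
  fix i assume i: "i \<le> d"
  have "coord scale d w i (split_vector scale A \<theta> u j) = 0" if "i < j" for j
    using that
  proof (induction j)
    case (Suc j)
    have "coord scale d w i (split_vector scale A \<theta> u (Suc j)) =
        (\<theta> i - \<theta> j) * coord scale d w i (split_vector scale A \<theta> u j)"
      using coord_eigenbasis[OF w(1) A w(2) i]
      by (simp add: split_vector_Suc[OF A] coord_diff[OF w(1)] coord_scale[OF w(1)] left_diff_distrib)
    then show ?case using Suc by (cases "i = j") auto
  qed simp
  then show "coord scale d w i (split_vector scale A \<theta> u (Suc d)) = 0" using i by simp
qed

lemma is_basis_singleton:
  assumes "subspace Z" "dim Z = 1" "x \<in> Z" "x \<noteq> 0"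
  shows "is_basis scale Z {x}"
proof -
  obtain B where B: "B \<subseteq> Z" "independent B" "Z \<subseteq> span B" "card B = 1"
    using basis_exists[of Z] assms(2) by metis
  then obtain b where b: "B = {b}" by (auto simp: card_1_singleton_iff)
  with B(3) assms(3) obtain c where c: "x = scale c b" by (auto simp: span_singleton)
  with assms(4) have "b = scale (inverse c) x" by auto
  then have "b \<in> span {x}" by (simp add: span_scale span_base)
  then have "Z \<subseteq> span {x}" using B(3) b by (metis empty_subsetI insert_subset span_minimal subset_trans subspace_span)
  moreover have "span {x} \<subseteq> Z" using assms by (simp add: span_minimal)
  ultimately show ?thesis using assms(4) by (auto simp: is_basis_def)
qed

end


section \<open>The zero diagonal space of a Leonard system\<close>

lemma balanced_combination_spans_zero_diagonal_space:
  fixes scale :: "'a::field \<Rightarrow> 'v::ab_group_add \<Rightarrow> 'v"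
  assumes "vector_space scale" and d: "d > 0"
    and A: "Vector_Spaces.linear scale scale A" and As: "Vector_Spaces.linear scale scale As"
    and basis: "ordered_basis scale d v"
    and tri: "irreducible_tridiagonal d (matrix_wrt scale d v A)"
    and eigen: "\<And>i. i \<le> d \<Longrightarrow> As (v i) = scale (\<theta>s i) (v i)"
    and inj: "inj_on \<theta>s {..d}"
    and Es: "\<And>i x. i \<le> d \<Longrightarrow> Es i x = scale (coord scale d v i x) (v i)"
    and a: "\<And>i. i \<le> d \<Longrightarrow> a i = coord scale d v i (A (v i))"
    and balanced: "balanced_weights d \<theta>s a cm cp" and nz: "cm \<noteq> 0 \<or> cp \<noteq> 0"
    and Xminus: "Xminus = (A - op_scale scale (a 0) id) \<circ> (As - op_scale scale (\<theta>s d) id)"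
    and Xplus: "Xplus = (A - op_scale scale (a d) id) \<circ> (As - op_scale scale (\<theta>s 0) id)"
  defines "Z \<equiv> zero_diagonal_space scale d A As Es"
    and "X \<equiv> op_scale scale cm Xminus - op_scale scale cp Xplus"
  shows "X \<noteq> 0" and "X \<in> Z"
    and "vector_space.dim (op_scale scale) Z = 1 \<Longrightarrow> is_basis (op_scale scale) Z {X}"
proof -
  interpret vector_space scale by fact
  interpret op: vector_space "op_scale scale :: 'a \<Rightarrow> ('v \<Rightarrow> 'v) \<Rightarrow> ('v \<Rightarrow> 'v)"
    by (rule vector_space_op_scale) fact
  interpret A: Vector_Spaces.linear scale scale A by fact
  interpret As: Vector_Spaces.linear scale scale As by fact
  note coords = coord_add[OF basis] coord_diff[OF basis] coord_scale[OF basis] coord_basis[OF basis]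
  have Xv: "X (v i) = scale (cm * (\<theta>s i - \<theta>s d)) (A (v i) - scale (a 0) (v i)) -
      scale (cp * (\<theta>s i - \<theta>s 0)) (A (v i) - scale (a d) (v i))" if "i \<le> d" for i
    unfolding X_def Xminus Xplus
    by (simp add: op_scale_def eigen[OF that] A.diff A.scale algebra_simps)
  have \<theta>s: "\<theta>s 0 \<noteq> \<theta>s d" using inj d by (auto dest: inj_onD)
  show nonzero: "X \<noteq> 0"
  proof
    assume "X = 0"
    have "cm * (\<theta>s 0 - \<theta>s d) * coord scale d v 1 (A (v 0)) = coord scale d v 1 (X (v 0))"
      using d unfolding Xv[OF le0] by (simp add: coords)
    moreover have "coord scale d v 1 (A (v 0)) \<noteq> 0"
      using tri d by (simp add: irreducible_tridiagonal_def matrix_wrt_def coord_def)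
    ultimately have "cm = 0" using \<theta>s \<open>X = 0\<close> by (simp add: coord_zero[OF basis])
    have "- (cp * (\<theta>s d - \<theta>s 0) * coord scale d v (d - 1) (A (v d))) = coord scale d v (d - 1) (X (v d))"
      unfolding Xv[OF order_refl] coord_diff[OF basis] coord_scale[OF basis] using d
      by (auto simp: coord_basis[OF basis])
    moreover have "coord scale d v (d - 1) (A (v d)) \<noteq> 0"
      using tri d by (cases d) (auto simp: irreducible_tridiagonal_def matrix_wrt_def coord_def)
    ultimately have "cp = 0" using \<theta>s \<open>X = 0\<close> by (simp add: coord_zero[OF basis])
    with \<open>cm = 0\<close> nz show False by simp
  qed
  have X_linear: "X (scale c x) = scale c (X x)" for c x
    unfolding X_def Xminus Xplus
    by (simp add: op_scale_def A.diff A.scale As.scale algebra_simps)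
  let ?S = "{id, As, A, A \<circ> As}"
  have "X = op_scale scale (cm - cp) (A \<circ> As) + op_scale scale (cp * \<theta>s 0 - cm * \<theta>s d) A +
      op_scale scale (cp * a d - cm * a 0) As + op_scale scale (cm * a 0 * \<theta>s d - cp * a d * \<theta>s 0) id"
    unfolding X_def Xminus Xplus
    by (rule ext) (simp add: op_scale_def A.diff A.scale algebra_simps)
  also have "\<dots> \<in> op.span ?S"
    by (intro op.span_add op.span_scale op.span_base) auto
  finally have "X \<in> op.span ?S" .
  moreover have "Es i \<circ> X \<circ> Es i = 0" if "i \<le> d" for i
  proof
    fix x
    have "coord scale d v i (X (v i)) =
        cm * (a i - a 0) * (\<theta>s i - \<theta>s d) - cp * (a i - a d) * (\<theta>s i - \<theta>s 0)"
      using that unfolding Xv[OF that] by (simp add: coords a[OF that, symmetric] algebra_simps)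
    also have "\<dots> = 0" using balanced that by (simp add: balanced_weights_def)
    finally show "(Es i \<circ> X \<circ> Es i) x = 0 x"
      by (simp add: Es[OF that] X_linear coords)
  qed
  ultimately show mem: "X \<in> Z" by (simp add: Z_def zero_diagonal_space_def)
  \<comment> \<open>Linearity of the outer factor in \<open>Es i \<circ> Y \<circ> Es i\<close> is
    what closes \<open>Z\<close> under sums and scalar multiples.\<close>
  have Es_linear: "Es i (x + y) = Es i x + Es i y" "Es i (scale c x) = scale c (Es i x)" "Es i 0 = 0"
    if "i \<le> d" for i x y c
    by (simp_all add: Es[OF that] coords coord_zero[OF basis] scale_left_distrib)
  have op_scale_apply: "op_scale scale c Y x = scale c (Y x)" for c Y and x :: 'v
    by (simp add: op_scale_def)
  have "op.subspace Z"
  proof (rule op.subspaceI)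
    show "0 \<in> Z"
      by (auto simp: Z_def zero_diagonal_space_def op.span_zero fun_eq_iff Es_linear)
    show "Y + Y' \<in> Z" if "Y \<in> Z" "Y' \<in> Z" for Y Y'
      using that by (auto simp: Z_def zero_diagonal_space_def op.span_add fun_eq_iff Es_linear)
    show "op_scale scale c Y \<in> Z" if "Y \<in> Z" for c Y
      using that by (auto simp: Z_def zero_diagonal_space_def op.span_scale fun_eq_iff Es_linear
          op_scale_apply)
  qed
  then show "is_basis (op_scale scale) Z {X}" if "op.dim Z = 1"
    using op.is_basis_singleton that mem nonzero by blast
qed

text \<open>An eigenvector for \<open>\<theta> i\<close> is fixed by \<open>E i\<close>, but would
  be killed by it if \<open>\<eta> i\<close> were a different eigenvalue. This identifies the
  eigenvalue sequences hidden in the existential definitions with the given ones.\<close>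

lemma eigenvalue_sequence_unique:
  assumes "eigenvalue_sequence scale d X E \<theta>" "eigenvalue_sequence scale d X E \<eta>" "i \<le> d"
  shows "\<theta> i = \<eta> i"
  using assms unfolding eigenvalue_sequence_def primitive_idempotent_def is_eigenvalue_def by metis

lemma standard_eigenbasis:
  assumes "standard_idempotent_ordering scale d X Y E" "eigenvalue_sequence scale d X E \<theta>"
  obtains v where "\<And>i. i \<le> d \<Longrightarrow> X (v i) = scale (\<theta> i) (v i)"
    and "ordered_basis scale d v" and "irreducible_tridiagonal d (matrix_wrt scale d v Y)"
    and "inj_on \<theta> {..d}"
proof -
  obtain \<eta> v where \<eta>: "bij_betw \<eta> {..d} {c. is_eigenvalue scale X c}"
      "\<And>i. i \<le> d \<Longrightarrow> X (v i) = scale (\<eta> i) (v i)" "tridiagonal_diagonal_basis scale d Y X v"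
      "eigenvalue_sequence scale d X E \<eta>"
    using assms(1) unfolding standard_idempotent_ordering_def standard_eigenvalue_ordering_def by blast
  have eq: "\<eta> i = \<theta> i" if "i \<le> d" for i
    using eigenvalue_sequence_unique[OF \<eta>(4) assms(2) that] .
  have "inj_on \<theta> {..d}"
    using \<eta>(1) eq by (auto simp: bij_betw_def inj_on_def)
  with \<eta>(2,3) eq that show thesis by (auto simp: tridiagonal_diagonal_basis_def)
qed

lemma leonard_diagonal_eq_split_diagonal:
  fixes scale :: "'a::field \<Rightarrow> 'v::ab_group_add \<Rightarrow> 'v"
  assumes "vector_space scale" and "leonard_system scale d A E As Es"
    and \<theta>: "eigenvalue_sequence scale d A E \<theta>" and \<theta>s: "eigenvalue_sequence scale d As Es \<theta>s"
    and split: "first_split_sequence scale d A E As Es \<phi>"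
    and v: "\<And>i. i \<le> d \<Longrightarrow> As (v i) = scale (\<theta>s i) (v i)" "ordered_basis scale d v"
      "irreducible_tridiagonal d (matrix_wrt scale d v A)" "inj_on \<theta>s {..d}"
    and i: "i \<le> d"
  shows "coord scale d v i (A (v i)) = split_diagonal d \<theta> \<theta>s \<phi> i"
proof -
  interpret vector_space scale by fact
  have A: "Vector_Spaces.linear scale scale A" and As: "Vector_Spaces.linear scale scale As"
    using assms(2) by (auto simp: leonard_system_def leonard_pair_def)
  obtain \<eta> \<eta>s where \<eta>: "eigenvalue_sequence scale d A E \<eta>" "eigenvalue_sequence scale d As Es \<eta>s"
    and split': "\<And>u j. u \<in> range (Es 0) - {0} \<Longrightarrow>
      As (split_vector scale A \<eta> u 0) = scale (\<eta>s 0) (split_vector scale A \<eta> u 0) \<and>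
      (j \<in> {1..d} \<longrightarrow> As (split_vector scale A \<eta> u j) =
        scale (\<eta>s j) (split_vector scale A \<eta> u j) + scale (\<phi> j) (split_vector scale A \<eta> u (j - 1)))"
    using split unfolding first_split_sequence_def Let_def by blast
  have eq: "\<eta> j = \<theta> j" "\<eta>s j = \<theta>s j" if "j \<le> d" for j
    using eigenvalue_sequence_unique[OF \<eta>(1) \<theta> that] eigenvalue_sequence_unique[OF \<eta>(2) \<theta>s that] by auto
  \<comment> \<open>An eigenbasis of \<open>A\<close> is needed only to see that the split vector
    with index \<open>Suc d\<close> vanishes.\<close>
  obtain w where w: "\<And>i. i \<le> d \<Longrightarrow> A (w i) = scale (\<eta> i) (w i)" "ordered_basis scale d w"
    using standard_eigenbasis[of scale d A As E \<eta>] assms(2) \<eta>(1) unfolding leonard_system_def by metis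
  have "Es 0 (v 0) = v 0"
    using \<theta>s v(1)[of 0] by (auto simp: eigenvalue_sequence_def primitive_idempotent_def)
  moreover have "v 0 \<noteq> 0"
    using coord_basis[OF v(2), of 0 0] coord_zero[OF v(2), of 0] by auto
  ultimately have u: "v 0 \<in> range (Es 0) - {0}" by (metis Diff_iff rangeI singletonD)
  define U where "U = split_vector scale A \<eta> (v 0)"
  have A_U: "A (U j) = U (Suc j) + scale (\<eta> j) (U j)" for j
    by (simp add: U_def split_vector_Suc[OF A])
  show ?thesis
  proof (rule tridiagonal_coord_eq_split_diagonal[OF v(2) A v(3) As v(1,4)])
    show "U 0 \<noteq> 0" using \<open>v 0 \<noteq> 0\<close> by (simp add: U_def split_vector_def)
    show "As (U 0) = scale (\<theta>s 0) (U 0)" using split'[OF u] eq by (simp add: U_def)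
    show "A (U j) = U (Suc j) + scale (\<theta> j) (U j)" if "j < d" for j using A_U eq that by simp
    show "A (U d) = scale (\<theta> d) (U d)"
      using A_U[of d] split_vector_eq_zero[OF A w(2,1)] eq by (simp add: U_def)
    show "As (U j) = scale (\<theta>s j) (U j) + scale (\<phi> j) (U (j - 1))" if "j \<in> {1..d}" for j
      using split'[OF u, of j] eq[of j] that by (simp add: U_def)
  qed (use i in auto)
qed

section \<open>The types involving q\<close>

text \<open>With \<open>Q = q ^ i\<close> and \<open>D = q ^ d\<close>, the left side is
  \<open>a i - a 0\<close> for \<open>ss = w ^ 2\<close>, and \<open>X (q ^ i)\<close> is the
  quotient of \<open>\<phi> i\<close> by the difference of dual eigenvalues. The factors
  \<open>1 - Q\<close> and \<open>1 - w ^ 2 * q * Q\<close> on the right are those of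
  \<open>\<theta>s i - \<theta>s 0\<close>.\<close>

lemma q_diagonal_difference_first:
  fixes h q s w D Q :: "'a::field"
  assumes "q \<noteq> 1" "q \<noteq> 0" "Q \<noteq> 0" "D \<noteq> 0" "1 + w * Q \<noteq> 0" "1 + w * (q * Q) \<noteq> 0" "1 + w * q \<noteq> 0"
  defines "X \<equiv> (\<lambda>P. h * (1 - P) * (q * D - P) * (1 - s * w * q * D * P) / (P * D * (1 - q) * (1 + w * P)))"
  shows "h * (1 - Q) * (1 - s * q * Q) / Q + X Q - X (q * Q) + X q =
    - h * (1 + w * q * D) * (1 + s * q * D) * (1 - Q) * (1 - w ^ 2 * q * Q) /
       ((1 + w * Q) * (1 + w * (q * Q)) * (1 + w * q) * D)"
proof -
  \<comment> \<open>As atoms, the denominators can be cleared by \<open>divide_simps\<close> without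
    being expanded; unfolding them afterwards leaves a polynomial identity.\<close>
  define u M M' M'' where "u = 1 - q" and "M = 1 + w * Q" and "M' = 1 + w * (q * Q)"
    and "M'' = 1 + w * q"
  have nz: "u \<noteq> 0" "M \<noteq> 0" "M' \<noteq> 0" "M'' \<noteq> 0"
    using assms by (simp_all add: u_def M_def M'_def M''_def)
  show ?thesis
    unfolding X_def M_def[symmetric] M'_def[symmetric] M''_def[symmetric] u_def[symmetric]
    using nz assms(2-4)
    apply (simp add: divide_simps)
    unfolding M_def M'_def M''_def u_def
    by algebra
qed

text \<open>The counterpart for \<open>a i - a d\<close>: now the factors \<open>D - Q\<close> and
  \<open>1 - w ^ 2 * q * D * Q\<close> of \<open>\<theta>s i - \<theta>s d\<close> appear, while the
  denominators involving \<open>Q\<close> are the same as before.\<close>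

lemma q_diagonal_difference_last:
  fixes h q s w D Q :: "'a::field"
  assumes "q \<noteq> 1" "q \<noteq> 0" "Q \<noteq> 0" "D \<noteq> 0" "1 + w * Q \<noteq> 0" "1 + w * (q * Q) \<noteq> 0" "1 + w * D \<noteq> 0"
  defines "X \<equiv> (\<lambda>P. h * (1 - P) * (q * D - P) * (1 - s * w * q * D * P) / (P * D * (1 - q) * (1 + w * P)))"
  shows "h * (1 - Q) * (1 - s * q * Q) / Q + X Q - X (q * Q) -
      (h * (1 - D) * (1 - s * q * D) / D + X D) =
    - h * (1 + w) * (1 + s * q * D) * (D - Q) * (1 - w ^ 2 * q * D * Q) /
       ((1 + w * Q) * (1 + w * (q * Q)) * (1 + w * D) * D)"
proof -
  define u M M' M'' where "u = 1 - q" and "M = 1 + w * Q" and "M' = 1 + w * (q * Q)"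
    and "M'' = 1 + w * D"
  have nz: "u \<noteq> 0" "M \<noteq> 0" "M' \<noteq> 0" "M'' \<noteq> 0"
    using assms by (simp_all add: u_def M_def M'_def M''_def)
  show ?thesis
    unfolding X_def M_def[symmetric] M'_def[symmetric] M''_def[symmetric] u_def[symmetric]
    using nz assms(2-4)
    apply (simp add: divide_simps)
    unfolding M_def M'_def M''_def u_def
    by algebra
qed

text \<open>
  Here \<open>s\<^sup>* = w\<^sup>2\<close>, and \<open>r\<^sub>2 = s w q\<^bsup>d+1\<^esup>\<close> has been eliminated by means of
  \<open>r\<^sub>1 r\<^sub>2 = s s\<^sup>* q\<^bsup>d+1\<^esup>\<close>. Nothing is assumed nonzero but \<open>q\<close>, so that \<open>s = 0\<close> gives the
  \<open>q\<close>-Hahn and \<open>w = 0\<close> the dual \<open>q\<close>-Krawtchouk type.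
\<close>

lemma q_balanced:
  fixes q h hs s w :: "'a::field"
  assumes d: "d > 0" and q: "q \<noteq> 0"
    and distinct: "\<And>i. i \<in> {1..d} \<Longrightarrow> \<theta>s i \<noteq> \<theta>s (i - 1)"
    and \<theta>: "\<And>i. i \<le> d \<Longrightarrow> \<theta> i = \<theta> 0 + h * (1 - q ^ i) * (1 - s * q ^ (i + 1)) * q powi (- int i)"
    and \<theta>s: "\<And>i. i \<le> d \<Longrightarrow>
      \<theta>s i = \<theta>s 0 + hs * (1 - q ^ i) * (1 - w ^ 2 * q ^ (i + 1)) * q powi (- int i)"
    and \<phi>: "\<And>i. i \<in> {1..d} \<Longrightarrow> \<phi> i = h * hs * q powi (1 - 2 * int i) * (1 - q ^ i) *
        (1 - q powi (int i - int d - 1)) * (1 - w * q ^ i) * (1 - s * w * q ^ (d + 1) * q ^ i)"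
  shows "balanced_weights d \<theta>s (split_diagonal d \<theta> \<theta>s \<phi>)
    (q ^ d * (w + 1) * (w * q + 1)) ((w * q ^ d + 1) * (w * q ^ (d + 1) + 1))"
proof -
  define X where "X P = h * (1 - P) * (q * q ^ d - P) * (1 - s * w * q * q ^ d * P) /
    (P * q ^ d * (1 - q) * (1 + w * P))" for P
  have \<theta>': "\<theta> i = \<theta> 0 + h * (1 - q ^ i) * (1 - s * q * q ^ i) / q ^ i" if "i \<le> d" for i
    using \<theta>[OF that] by (simp add: power_int_minus divide_inverse mult_ac)
  have \<theta>s': "\<theta>s i = \<theta>s 0 + hs * (1 - q ^ i) * (1 - w ^ 2 * q * q ^ i) / q ^ i" if "i \<le> d" for i
    using \<theta>s[OF that] by (simp add: power_int_minus divide_inverse mult_ac)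
  \<comment> \<open>Here the square matters: \<open>1 - w ^ 2 * q ^ (2 * i)\<close> splits, and its
    factor \<open>1 - w * q ^ i\<close> will cancel against the same factor of
    \<open>\<phi> i\<close>.\<close>
  have \<theta>s_diff: "\<theta>s i - \<theta>s (i - 1) = hs * (1 - q) * (1 - w * q ^ i) * (1 + w * q ^ i) / q ^ i"
    if i: "i \<in> {1..d}" for i
  proof -
    obtain j where j: "i = Suc j" using i by (cases i) auto
    define P where "P = q ^ j"
    have "\<theta>s i - \<theta>s (i - 1) =
      hs * (1 - q * P) * (1 - w ^ 2 * q * (q * P)) / (q * P) - hs * (1 - P) * (1 - w ^ 2 * q * P) / P"
      using \<theta>s'[of i] \<theta>s'[of j] i by (simp add: j P_def)
    also have "\<dots> = hs * (1 - q) * (1 - w * (q * P)) * (1 + w * (q * P)) / (q * P)"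
      using q by (simp add: P_def divide_simps) algebra
    finally show ?thesis by (simp add: j P_def)
  qed
  \<comment> \<open>Distinct consecutive dual eigenvalues force every factor of their difference to
    be nonzero.\<close>
  have nz: "q \<noteq> 1" "hs \<noteq> 0" "1 - w * q ^ i \<noteq> 0" "1 + w * q ^ i \<noteq> 0" if "i \<in> {1..d}" for i
    using distinct[OF that] \<theta>s_diff[OF that] by auto
  have X: "\<forall>i\<in>{1..d}. \<phi> i / (\<theta>s i - \<theta>s (i - 1)) = X (q ^ i)"
  proof
    fix i assume i: "i \<in> {1..d}"
    have 1: "q powi (1 - 2 * int i) = q / (q ^ i) ^ 2"
      using power_int_diff[of q 1 "int (2 * i)"] q
      by (simp only: power_int_of_nat power_mult mult.commute[of 2 i]) (simp add: mult.commute)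
    have 2: "1 - q powi (int i - int d - 1) = (q * q ^ d - q ^ i) / (q * q ^ d)"
      using q by (simp add: power_int_diff power_int_add field_simps)
    have cancel: "h * hs * (q / P ^ 2) * a * (b / (q * D)) * M * c / (hs * u * M * M' / P) =
        h * a * b * c / (P * D * u * M')"
      if "hs \<noteq> 0" "P \<noteq> 0" "u \<noteq> 0" "M \<noteq> 0" "M' \<noteq> 0" "D \<noteq> 0" for hs P u M M' a b c D :: 'a
      using that q by (simp add: divide_simps power2_eq_square)
    show "\<phi> i / (\<theta>s i - \<theta>s (i - 1)) = X (q ^ i)"
      using cancel[of hs "q ^ i" "1 - q" "1 - w * q ^ i" "1 + w * q ^ i" "q ^ d" "1 - q ^ i"
          "q * q ^ d - q ^ i" "1 - s * w * q * q ^ d * q ^ i"] nz[OF i] q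
      unfolding \<phi>[OF i] \<theta>s_diff[OF i] X_def 1 2 by (simp add: mult_ac)
  qed
  note diag = split_diagonal_eq[where X = "\<lambda>i. X (q ^ i)" and \<theta> = \<theta>, OF d X]
  show ?thesis
  proof (rule balanced_weightsI)
    fix i assume i: "0 < i" "i < d"
    define Q where "Q = q ^ i"
    define D where "D = q ^ d"
    have nz': "Q \<noteq> 0" "D \<noteq> 0" "1 + w * Q \<noteq> 0" "1 + w * (q * Q) \<noteq> 0" "1 + w * q \<noteq> 0"
      "1 + w * D \<noteq> 0" "q \<noteq> 1"
      using nz[of i] nz[of "Suc i"] nz[of 1] nz[of d] i q d by (auto simp: Q_def D_def)
    let ?a = "split_diagonal d \<theta> \<theta>s \<phi>"
    have "?a i - ?a 0 = h * (1 - Q) * (1 - s * q * Q) / Q + X Q - X (q * Q) + X q"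
      using diag(1) diag(3)[OF i] \<theta>'[of i] i by (simp add: Q_def)
    also have "\<dots> = - h * (1 + w * q * D) * (1 + s * q * D) * (1 - Q) * (1 - w ^ 2 * q * Q) /
       ((1 + w * Q) * (1 + w * (q * Q)) * (1 + w * q) * D)"
      unfolding X_def D_def[symmetric] by (rule q_diagonal_difference_first) (use nz' q in auto)
    finally have a0: "?a i - ?a 0 = \<dots>" .
    have "?a i - ?a d = h * (1 - Q) * (1 - s * q * Q) / Q + X Q - X (q * Q) -
      (h * (1 - D) * (1 - s * q * D) / D + X D)"
      using diag(2) diag(3)[OF i] \<theta>'[of i] \<theta>'[of d] i by (simp add: Q_def D_def)
    also have "\<dots> = - h * (1 + w) * (1 + s * q * D) * (D - Q) * (1 - w ^ 2 * q * D * Q) /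
       ((1 + w * Q) * (1 + w * (q * Q)) * (1 + w * D) * D)"
      unfolding X_def D_def[symmetric] by (rule q_diagonal_difference_last) (use nz' q in auto)
    finally have ad: "?a i - ?a d = \<dots>" .
    have \<theta>s0: "\<theta>s i - \<theta>s 0 = hs * (1 - Q) * (1 - w ^ 2 * q * Q) / Q"
      using \<theta>s'[of i] i by (simp add: Q_def)
    have \<theta>sd: "\<theta>s i - \<theta>s d = hs * (D - Q) * (1 - w ^ 2 * q * D * Q) / (Q * D)"
    proof -
      have "\<theta>s i - \<theta>s d = hs * (1 - Q) * (1 - w ^ 2 * q * Q) / Q - hs * (1 - D) * (1 - w ^ 2 * q * D) / D"
        using \<theta>s'[of i] \<theta>s'[of d] i by (simp add: Q_def D_def)
      also have "\<dots> = hs * (D - Q) * (1 - w ^ 2 * q * D * Q) / (Q * D)"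
        using nz'(1,2) by (simp add: divide_simps) algebra
      finally show ?thesis .
    qed
    \<comment> \<open>Treating the factors as variables turns the claim into a pure cancellation.
      Both difference quotients depend on \<open>i\<close> only through
      \<open>Q / (M1 * M2)\<close>; the remaining constants \<open>b2 / (D * M3)\<close> and
      \<open>b1 / M4\<close>, cross-multiplied, are the weights.\<close>
    have cancel: "D * b1 * M3 * (- h * b2 * b3 * b4 * b5 / (M1 * M2 * M3 * D)) * (hs * c1 * c2 / (Q * D)) =
        M4 * b2 * (- h * b1 * b3 * c1 * c2 / (M1 * M2 * M4 * D)) * (hs * b4 * b5 / Q)"
      if "M1 \<noteq> 0" "M2 \<noteq> 0" "M3 \<noteq> 0" "M4 \<noteq> 0" for M1 M2 M3 M4 b1 b2 b3 b4 b5 c1 c2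
      using that nz'(1,2) by (simp add: divide_simps)
    have comm: "w + 1 = 1 + w" "w * q + 1 = 1 + w * q" "w * D + 1 = 1 + w * D"
        "w * (D * q) + 1 = 1 + w * q * D"
      by (simp_all add: algebra_simps)
    show "q ^ d * (w + 1) * (w * q + 1) * (?a i - ?a 0) * (\<theta>s i - \<theta>s d) =
      (w * q ^ d + 1) * (w * q ^ (d + 1) + 1) * (?a i - ?a d) * (\<theta>s i - \<theta>s 0)"
      unfolding a0 ad \<theta>s0 \<theta>sd power_add power_one_right D_def[symmetric] comm
      by (rule cancel) (use nz' in auto)
  qed
qed

section \<open>The types of Racah, Hahn and Krawtchouk\<close>

text \<open>Both sides become \<open>k * (\<theta>s i - \<theta>s 0) * (\<theta>s i - \<theta>s
  d)\<close>. An affine dependence is the source of the weights \<open>1\<close>,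
  \<open>1\<close>.\<close>

lemma affine_balanced:
  assumes "\<And>i. i \<le> d \<Longrightarrow> a i = c + k * \<theta>s i"
  shows "balanced_weights d \<theta>s a 1 (1::'a::field)"
  unfolding balanced_weights_def using assms by (simp add: algebra_simps)

text \<open>The differences of dual eigenvalues are constant, so \<open>X\<close> is quadratic in
  \<open>i\<close> and its successive differences are linear. Thus the diagonal entry is affine in
  \<open>i\<close>, hence in \<open>\<theta>s i\<close>.\<close>

lemma krawtchouk_balanced:
  fixes s ss r :: "'a::field"
  assumes d: "d > 0"
    and distinct: "\<And>i. i \<in> {1..d} \<Longrightarrow> \<theta>s i \<noteq> \<theta>s (i - 1)"
    and \<theta>: "\<And>i. i \<le> d \<Longrightarrow> \<theta> i = \<theta> 0 + s * of_nat i"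
    and \<theta>s: "\<And>i. i \<le> d \<Longrightarrow> \<theta>s i = \<theta>s 0 + ss * of_nat i"
    and \<phi>: "\<And>i. i \<in> {1..d} \<Longrightarrow> \<phi> i = r * of_nat i * (of_nat i - of_nat d - 1)"
  shows "balanced_weights d \<theta>s (split_diagonal d \<theta> \<theta>s \<phi>) 1 1"
proof -
  have \<theta>s_diff: "\<theta>s i - \<theta>s (i - 1) = ss" if "i \<in> {1..d}" for i
  proof -
    obtain j where "i = Suc j" using \<open>i \<in> {1..d}\<close> by (cases i) auto
    then show ?thesis using \<theta>s[of i] \<theta>s[of j] that by (simp add: algebra_simps)
  qed
  have ss: "ss \<noteq> 0" using distinct[of 1] \<theta>s_diff[of 1] d by auto
  define X where "X n = r * n * (n - of_nat d - 1) / ss" for n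
  have X: "\<forall>i\<in>{1..d}. \<phi> i / (\<theta>s i - \<theta>s (i - 1)) = X (of_nat i)"
  proof
    fix i assume i: "i \<in> {1..d}"
    show "\<phi> i / (\<theta>s i - \<theta>s (i - 1)) = X (of_nat i)"
      unfolding \<phi>[OF i] \<theta>s_diff[OF i] X_def ..
  qed
  note diag = split_diagonal_eq[where X = "\<lambda>i. X (of_nat i)" and \<theta> = \<theta>, OF d X]
  \<comment> \<open>Since \<open>X n - X (n + 1) = r * (of_nat d - 2 * n) / ss\<close>, the slope in
    \<open>i\<close> is \<open>s - 2 * r / ss\<close>; dividing by the slope \<open>ss\<close> of
    \<open>\<theta>s\<close> gives \<open>k\<close>.\<close>
  define k where "k = s / ss - 2 * r / ss ^ 2"
  show ?thesis
  proof (rule affine_balanced)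
    fix i assume "i \<le> d"
    then consider "i = 0" | "i = d" "0 < i" | "0 < i" "i < d" by linarith
    then show "split_diagonal d \<theta> \<theta>s \<phi> i = (\<theta> 0 + r * of_nat d / ss - k * \<theta>s 0) + k * \<theta>s i"
    proof cases
      case 1
      then show ?thesis using diag(1) by (simp add: X_def)
    next
      case 2
      have "\<theta> 0 + s * m = \<theta> 0 + r * m / ss - k * \<theta>s 0 + k * (\<theta>s 0 + ss * m) + r * m / ss" for m
        using ss by (simp add: k_def divide_simps; algebra)
      then show ?thesis
        using diag(2) \<theta>[of d] \<theta>s[of d] 2 by (simp add: X_def)
    next
      case 3
      have "\<theta> 0 + s * n + r * n * (n - m - 1) / ss - r * (n + 1) * (n + 1 - m - 1) / ss =
        \<theta> 0 + r * m / ss - k * \<theta>s 0 + k * (\<theta>s 0 + ss * n)" for n m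
        using ss by (simp add: k_def divide_simps; algebra)
      then show ?thesis
        using diag(3)[OF 3] \<theta>[of i] \<theta>s[of i] 3 by (simp add: X_def add.commute[of 1])
    qed
  qed
qed

text \<open>For \<open>ss = 2 * r\<close> the factor \<open>of_nat i + r\<close> cancels, so
  \<open>X\<close> is a cubic polynomial. The diagonal entry is then quadratic in \<open>i\<close>
  and turns out to be affine in \<open>\<theta>s i\<close>.\<close>

lemma racah_balanced:
  fixes h hs s r :: "'a::field"
  assumes d: "d > 0"
    and distinct: "\<And>i. i \<in> {1..d} \<Longrightarrow> \<theta>s i \<noteq> \<theta>s (i - 1)"
    and \<theta>: "\<And>i. i \<le> d \<Longrightarrow> \<theta> i = \<theta> 0 + h * of_nat i * (of_nat i + 1 + s)"
    and \<theta>s: "\<And>i. i \<le> d \<Longrightarrow> \<theta>s i = \<theta>s 0 + hs * of_nat i * (of_nat i + 1 + 2 * r)"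
    and \<phi>: "\<And>i. i \<in> {1..d} \<Longrightarrow> \<phi> i = h * hs * of_nat i * (of_nat i - of_nat d - 1) *
      (of_nat i + r) * (of_nat i + (s + r + of_nat d + 1))"
  shows "balanced_weights d \<theta>s (split_diagonal d \<theta> \<theta>s \<phi>) 1 1"
proof -
  have \<theta>s_diff: "\<theta>s i - \<theta>s (i - 1) = 2 * hs * (of_nat i + r)" if "i \<in> {1..d}" for i
  proof -
    obtain j where "i = Suc j" using \<open>i \<in> {1..d}\<close> by (cases i) auto
    then show ?thesis using \<theta>s[of i] \<theta>s[of j] that by (simp add: algebra_simps)
  qed
  have nz: "hs \<noteq> 0" "(2::'a) \<noteq> 0" "of_nat i + r \<noteq> 0" if "i \<in> {1..d}" for i
    using distinct[OF that] \<theta>s_diff[OF that] by auto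
  \<comment> \<open>One half is kept as a constant with \<open>2 * c = 1\<close>, so that the
    identities below are polynomial consequences of this equation and of the one for
    \<open>k * hs\<close>.\<close>
  define c :: 'a where "c = 1 / 2"
  define X where "X n = h * n * (n - of_nat d - 1) * (n + (s + r + of_nat d + 1)) * c" for n
  have X: "\<forall>i\<in>{1..d}. \<phi> i / (\<theta>s i - \<theta>s (i - 1)) = X (of_nat i)"
  proof
    fix i assume i: "i \<in> {1..d}"
    have "h * hs * a * b * M * e / (2 * hs * M) = h * a * b * e * c" if "M \<noteq> 0" for a b e M
      using that nz(1,2)[OF i] by (simp add: c_def divide_simps)
    then show "\<phi> i / (\<theta>s i - \<theta>s (i - 1)) = X (of_nat i)"
      unfolding \<phi>[OF i] \<theta>s_diff[OF i] X_def using nz(3)[OF i] .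
  qed
  note diag = split_diagonal_eq[where X = "\<lambda>i. X (of_nat i)" and \<theta> = \<theta>, OF d X]
  have nz1: "hs \<noteq> 0" "(2::'a) \<noteq> 0" using nz[of 1] d by auto
  have c: "2 * c = 1" using nz1 by (simp add: c_def)
  \<comment> \<open>The slope comes from comparing leading terms: \<open>X n - X (n + 1)\<close>
    contributes \<open>- 3 * h * c\<close> to the coefficient of \<open>n ^ 2\<close>,
    \<open>\<theta>\<close> contributes \<open>h\<close>, and \<open>\<theta>s\<close> has leading
    coefficient \<open>hs\<close>.\<close>
  define k where "k = - h * c / hs"
  have k: "k * hs = - h * c" using nz1 by (simp add: k_def)
  show ?thesis
  proof (rule affine_balanced)
    fix i assume "i \<le> d"
    then consider "i = 0" | "i = d" "0 < i" | "0 < i" "i < d" by linarith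
    then show "split_diagonal d \<theta> \<theta>s \<phi> i = (\<theta> 0 - X 1 - k * \<theta>s 0) + k * \<theta>s i"
    proof cases
      case 1
      then show ?thesis using diag(1) by simp
    next
      case 2
      have "\<theta> 0 + h * m * (m + 1 + s) + h * m * (m - m - 1) * (m + (s + r + m + 1)) * c =
        \<theta> 0 - h * 1 * (1 - m - 1) * (1 + (s + r + m + 1)) * c - k * \<theta>s 0 +
          k * (\<theta>s 0 + hs * m * (m + 1 + 2 * r))" for m
        using c k by algebra
      then show ?thesis
        using diag(2) \<theta>[of d] \<theta>s[of d] 2 by (simp add: X_def)
    next
      case 3
      have "\<theta> 0 + h * n * (n + 1 + s) + h * n * (n - m - 1) * (n + (s + r + m + 1)) * c -
          h * (n + 1) * (n + 1 - m - 1) * (n + 1 + (s + r + m + 1)) * c =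
        \<theta> 0 - h * 1 * (1 - m - 1) * (1 + (s + r + m + 1)) * c - k * \<theta>s 0 +
          k * (\<theta>s 0 + hs * n * (n + 1 + 2 * r))" for n m
        using c k by algebra
      then show ?thesis
        using diag(3)[OF 3] \<theta>[of i] \<theta>s[of i] 3 by (simp add: X_def add.commute[of 1])
    qed
  qed
qed

text \<open>Here \<open>r\<close> is free, so the denominators \<open>2 * of_nat i + ss\<close>
  stay. Both difference quotients nevertheless share the factor
  \<open>s * (2 * r - ss) / (M1 * M2)\<close>; what differs is \<open>(ss + 2 * m + 2) / M3\<close>
  against \<open>ss / M4\<close>, and these give the weights.\<close>

lemma hahn_balanced:
  fixes hs s ss r :: "'a::field"
  assumes d: "d > 0"
    and distinct: "\<And>i. i \<in> {1..d} \<Longrightarrow> \<theta>s i \<noteq> \<theta>s (i - 1)"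
    and \<theta>: "\<And>i. i \<le> d \<Longrightarrow> \<theta> i = \<theta> 0 + s * of_nat i"
    and \<theta>s: "\<And>i. i \<le> d \<Longrightarrow> \<theta>s i = \<theta>s 0 + hs * of_nat i * (of_nat i + 1 + ss)"
    and \<phi>: "\<And>i. i \<in> {1..d} \<Longrightarrow>
      \<phi> i = hs * s * of_nat i * (of_nat i - of_nat d - 1) * (of_nat i + r)"
  shows "balanced_weights d \<theta>s (split_diagonal d \<theta> \<theta>s \<phi>)
    (ss * (ss + 2)) ((ss + 2 * of_nat d) * (ss + 2 * of_nat d + 2))"
proof -
  have \<theta>s_diff: "\<theta>s i - \<theta>s (i - 1) = hs * (2 * of_nat i + ss)" if "i \<in> {1..d}" for i
  proof -
    obtain j where "i = Suc j" using \<open>i \<in> {1..d}\<close> by (cases i) auto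
    then show ?thesis using \<theta>s[of i] \<theta>s[of j] that by (simp add: algebra_simps)
  qed
  have nz: "hs \<noteq> 0" "2 * of_nat i + ss \<noteq> 0" if "i \<in> {1..d}" for i
    using distinct[OF that] \<theta>s_diff[OF that] by auto
  define X where "X n = s * n * (n - of_nat d - 1) * (n + r) / (2 * n + ss)" for n
  have X: "\<forall>i\<in>{1..d}. \<phi> i / (\<theta>s i - \<theta>s (i - 1)) = X (of_nat i)"
  proof
    fix i assume i: "i \<in> {1..d}"
    have "hs * s * a * b * e / (hs * M) = s * a * b * e / M" for a b e M
      using nz(1)[OF i] by simp
    then show "\<phi> i / (\<theta>s i - \<theta>s (i - 1)) = X (of_nat i)"
      unfolding \<phi>[OF i] \<theta>s_diff[OF i] X_def .
  qed
  note diag = split_diagonal_eq[where X = "\<lambda>i. X (of_nat i)" and \<theta> = \<theta>, OF d X]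
  show ?thesis
  proof (rule balanced_weightsI)
    fix i assume i: "0 < i" "i < d"
    let ?a = "split_diagonal d \<theta> \<theta>s \<phi>"
    define n m :: 'a where "n = of_nat i" and "m = of_nat d"
    define M1 M2 M3 M4 where "M1 = 2 * n + ss" and "M2 = 2 * (n + 1) + ss" and "M3 = 2 * 1 + ss"
      and "M4 = 2 * m + ss"
    note M = M1_def M2_def M3_def M4_def
    have nz': "M1 \<noteq> 0" "M2 \<noteq> 0" "M3 \<noteq> 0" "M4 \<noteq> 0"
      using nz(2)[of i] nz(2)[of "Suc i"] nz(2)[of 1] nz(2)[of d] i d
      by (auto simp: M n_def m_def add.commute[of 1])
    have "?a i - ?a 0 = s * n + s * n * (n - m - 1) * (n + r) / M1 -
        s * (n + 1) * (n + 1 - m - 1) * (n + 1 + r) / M2 + s * 1 * (1 - m - 1) * (1 + r) / M3"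
      using diag(1) diag(3)[OF i] \<theta>[of i] i
      by (simp add: X_def M n_def m_def add.commute[of 1])
    also have "\<dots> = - s * (2 * r - ss) * (ss + 2 * m + 2) * n * (n + 1 + ss) / (M1 * M2 * M3)"
      using nz' by (simp add: divide_simps; unfold M; algebra)
    finally have a0: "?a i - ?a 0 = \<dots>" .
    have "?a i - ?a d = s * n + s * n * (n - m - 1) * (n + r) / M1 -
        s * (n + 1) * (n + 1 - m - 1) * (n + 1 + r) / M2 - s * m - s * m * (m - m - 1) * (m + r) / M4"
      using diag(2) diag(3)[OF i] \<theta>[of i] \<theta>[of d] i
      by (simp add: X_def M n_def m_def add.commute[of 1])
    also have "\<dots> = - s * (2 * r - ss) * ss * (n - m) * (n + m + 1 + ss) / (M1 * M2 * M4)"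
      using nz' by (simp add: divide_simps; unfold M; algebra)
    finally have ad: "?a i - ?a d = \<dots>" .
    have \<theta>s0: "\<theta>s i - \<theta>s 0 = hs * n * (n + 1 + ss)"
      using \<theta>s[of i] i by (simp add: n_def)
    have \<theta>sd: "\<theta>s i - \<theta>s d = hs * (n - m) * (n + m + 1 + ss)"
      using \<theta>s[of i] \<theta>s[of d] i by (simp add: n_def m_def algebra_simps)
    have cancel: "ss * M3 * (- s * b1 * b2 * b3 * b4 / (M1 * M2 * M3)) * (hs * c1 * c2) =
        M4 * b2 * (- s * b1 * ss * c1 * c2 / (M1 * M2 * M4)) * (hs * b3 * b4)" for b1 b2 b3 b4 c1 c2
      using nz' by (simp add: divide_simps)
    have comm: "ss + 2 = M3" "ss + 2 * m = M4"
      by (simp_all add: M)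
    show "ss * (ss + 2) * (?a i - ?a 0) * (\<theta>s i - \<theta>s d) =
      (ss + 2 * of_nat d) * (ss + 2 * of_nat d + 2) * (?a i - ?a d) * (\<theta>s i - \<theta>s 0)"
      using cancel[of "2 * r - ss" "ss + 2 * m + 2" n "n + 1 + ss" "n - m" "n + m + 1 + ss"]
      unfolding a0 ad \<theta>s0 \<theta>sd m_def[symmetric] comm .
  qed
qed

section \<open>The Bannai/Ito type\<close>

lemma alternating_sequence:
  fixes h s :: "'a::field"
  assumes "f i = f 0 + h * (s - 1 + (1 - s + 2 * of_nat i) * (- 1) ^ i)"
  shows "even i \<Longrightarrow> f i = f 0 + 2 * h * of_nat i"
    and "odd i \<Longrightarrow> f i = f 0 + 2 * h * (s - 1 - of_nat i)"
  using assms by (simp_all add: algebra_simps)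

text \<open>With \<open>ss = - 2 * r\<close> the differences for both parities are multiples of the
  same linear factor \<open>of_nat i + r\<close>, which also occurs in \<open>\<phi> i\<close> for
  one of the parities. In the uses below \<open>r\<close> is either of \<open>r1\<close>,
  \<open>r2\<close>.\<close>

lemma alternating_diff:
  fixes hs r :: "'a::field"
  assumes \<theta>s: "\<And>i. i \<le> d \<Longrightarrow> \<theta>s i = \<theta>s 0 + hs * (- 2 * r - 1 + (1 - (- 2 * r) + 2 * of_nat i) * (- 1) ^ i)"
    and i: "i \<in> {1..d}"
  shows "\<theta>s i - \<theta>s (i - 1) = (if even i then 4 * hs * (of_nat i + r) else - 4 * hs * (of_nat i + r))"
proof -
  obtain j where "i = Suc j" using i by (cases i) auto
  then show ?thesis
    using alternating_sequence[where f = \<theta>s, OF \<theta>s[of i]] alternating_sequence[where f = \<theta>s, OF \<theta>s[of j]] i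
    by (auto simp: algebra_simps)
qed

text \<open>The factor \<open>of_nat i + r\<close> cancels for even \<open>i\<close> only. Hence
  each inner diagonal entry has exactly one summand with a denominator, at \<open>i + 1\<close> for
  even \<open>i\<close> and at \<open>i\<close> for odd \<open>i\<close>; both parities lead to the
  same weights. The weight \<open>r + 1\<close> is the denominator of \<open>X\<close> at the odd
  index \<open>1\<close>.\<close>

lemma bannai_ito_even_balanced_1:
  fixes h hs s r r' :: "'a::field"
  assumes d: "d > 0" "even d"
    and distinct: "\<And>i. i \<in> {1..d} \<Longrightarrow> \<theta>s i \<noteq> \<theta>s (i - 1)"
    and sum: "r + r' = - s - (- 2 * r) + of_nat d + 1"
    and \<theta>: "\<And>i. i \<le> d \<Longrightarrow> \<theta> i = \<theta> 0 + h * (s - 1 + (1 - s + 2 * of_nat i) * (- 1) ^ i)"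
    and \<theta>s: "\<And>i. i \<le> d \<Longrightarrow>
      \<theta>s i = \<theta>s 0 + hs * (- 2 * r - 1 + (1 - (- 2 * r) + 2 * of_nat i) * (- 1) ^ i)"
    and \<phi>_even: "\<And>i. i \<in> {1..d} \<Longrightarrow> even i \<Longrightarrow> \<phi> i = - 4 * h * hs * of_nat i * (of_nat i + r)"
    and \<phi>_odd: "\<And>i. i \<in> {1..d} \<Longrightarrow> odd i \<Longrightarrow> \<phi> i = - 4 * h * hs * (of_nat i - of_nat d - 1) * (of_nat i + r')"
  shows "balanced_weights d \<theta>s (split_diagonal d \<theta> \<theta>s \<phi>) (r + 1) (r + of_nat d + 1)"
proof -
  note \<theta>s_diff = alternating_diff[where \<theta>s = \<theta>s, OF \<theta>s]
  have nz: "hs \<noteq> 0" "(4::'a) \<noteq> 0" "of_nat i + r \<noteq> 0" if "i \<in> {1..d}" for i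
    using distinct[OF that] \<theta>s_diff[OF _ that] by (auto split: if_splits)
  define m :: 'a where "m = of_nat d"
  \<comment> \<open>In terms of \<open>e\<close> the sum condition reads
    \<open>s = m + 1 - e\<close>, and \<open>e\<close> becomes a common factor of all differences of
    diagonal entries.\<close>
  define e where "e = r' - r"
  have s: "s = m + 1 - e" using sum by (simp add: e_def m_def algebra_simps)
  have r': "r' = r + e" by (simp add: e_def)
  define Xe Xo where "Xe n = - h * n" and "Xo n = h * (n - m - 1) * (n + r') / (n + r)" for n
  have X: "\<forall>i\<in>{1..d}. \<phi> i / (\<theta>s i - \<theta>s (i - 1)) = (if even i then Xe (of_nat i) else Xo (of_nat i))"
  proof
    fix i assume i: "i \<in> {1..d}"
    have cancel: "- 4 * h * hs * a * b / (4 * hs * b) = - h * a"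
        "- 4 * h * hs * a * c / (- 4 * hs * b) = h * a * c / b"
      if "b \<noteq> 0" for a b c
      using that nz(1,2)[OF i] by simp_all
    show "\<phi> i / (\<theta>s i - \<theta>s (i - 1)) = (if even i then Xe (of_nat i) else Xo (of_nat i))"
    proof (cases "even i")
      case True
      have diff: "\<theta>s i - \<theta>s (i - 1) = 4 * hs * (of_nat i + r)"
        using \<theta>s_diff[OF _ i] True by simp
      have "\<phi> i / (\<theta>s i - \<theta>s (i - 1)) = Xe (of_nat i)"
        unfolding \<phi>_even[OF i True] diff Xe_def m_def by (rule cancel[OF nz(3)[OF i]])
      then show ?thesis using True by simp
    next
      case False
      have diff: "\<theta>s i - \<theta>s (i - 1) = - 4 * hs * (of_nat i + r)"
        using \<theta>s_diff[OF _ i] False by simp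
      have "\<phi> i / (\<theta>s i - \<theta>s (i - 1)) = Xo (of_nat i)"
        unfolding \<phi>_odd[OF i False] diff Xo_def m_def by (rule cancel[OF nz(3)[OF i]])
      then show ?thesis using False by simp
    qed
  qed
  note diag = split_diagonal_eq[where \<theta> = \<theta>, OF d(1) X]
  note val = alternating_sequence[where f = \<theta>, OF \<theta>] alternating_sequence[where f = \<theta>s, OF \<theta>s]
  show ?thesis
  proof (rule balanced_weightsI)
    fix i assume i: "0 < i" "i < d"
    let ?a = "split_diagonal d \<theta> \<theta>s \<phi>"
    define n :: 'a where "n = of_nat i"
    define M1 M2 M3 where "M1 = n + r" and "M2 = n + 1 + r" and "M3 = 1 + r"
    note M = M1_def M2_def M3_def
    have nz': "M1 \<noteq> 0" "M2 \<noteq> 0" "M3 \<noteq> 0"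
      using nz(3)[of i] nz(3)[of "Suc i"] nz(3)[of 1] i d
      by (auto simp: M n_def m_def add.commute[of 1])
    \<comment> \<open>Expressing the variables by the denominators makes the latter independent indeterminates.\<close>
    have eqs: "n = M1 - r" "n = M2 - 1 - r" "r = M3 - 1"
      by (simp_all add: M)
    have comm: "r + 1 = M3" by (simp add: M)
    \<comment> \<open>\<open>M\<close> is \<open>M2\<close> for even and \<open>M1\<close> for odd
      \<open>i\<close>, and \<open>c\<close> is \<open>2 * hs\<close> or \<open>- 2 * hs\<close>;
      \<open>y\<close> and \<open>p\<close> are the remaining factors of
      \<open>\<theta>s i - \<theta>s 0\<close> and \<open>\<theta>s i - \<theta>s d\<close>.\<close>
    have balance: "M3 * (- h * e * y * k / (M * M3)) * (c * p) = k * (- h * e * p / M) * (c * y)"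
      if "M \<noteq> 0" for M c p y k
      using that nz'(3) by simp
    show "(r + 1) * (?a i - ?a 0) * (\<theta>s i - \<theta>s d) =
        (r + of_nat d + 1) * (?a i - ?a d) * (\<theta>s i - \<theta>s 0)"
    proof (cases "even i")
      case True
      have "?a i - ?a 0 = 2 * h * n + Xe n - Xo (n + 1) + Xo 1"
        using diag(1) diag(3)[OF i] val(1)[of i] True i
        by (simp add: n_def add.commute[of 1])
      also have "\<dots> = - h * e * n * (r + m + 1) / (M2 * M3)"
        using nz' unfolding Xe_def Xo_def s r' M[symmetric]
        unfolding eqs(2,3) by (simp add: divide_simps; simp add: algebra_simps)
      finally have a0: "?a i - ?a 0 = \<dots>" .
      have "?a i - ?a d = 2 * h * n + Xe n - Xo (n + 1) - (2 * h * m + Xe m)"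
        using diag(2) diag(3)[OF i] val(1)[of i] val(1)[of d] True i d
        by (simp add: n_def m_def add.commute[of 1])
      also have "\<dots> = - h * e * (n - m) / M2"
        using nz' unfolding Xe_def Xo_def s r' M[symmetric]
        unfolding eqs(2) by (simp add: divide_simps; simp add: algebra_simps)
      finally have ad: "?a i - ?a d = \<dots>" .
      have \<theta>s0: "\<theta>s i - \<theta>s 0 = 2 * hs * n"
        using val(3)[of i] True i by (simp add: n_def)
      have \<theta>sd: "\<theta>s i - \<theta>s d = 2 * hs * (n - m)"
        using val(3)[of i] val(3)[of d] True i d by (simp add: n_def m_def algebra_simps)
      show ?thesis
        unfolding a0 ad \<theta>s0 \<theta>sd m_def[symmetric] comm by (rule balance) (use nz' in auto)
    next
      case False
      have "?a i - ?a 0 = 2 * h * (s - 1 - n) + Xo n - Xe (n + 1) + Xo 1"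
        using diag(1) diag(3)[OF i] val(2)[of i] False i
        by (simp add: n_def add.commute[of 1])
      also have "\<dots> = - h * e * (n + 1 + 2 * r) * (r + m + 1) / (M1 * M3)"
        using nz' unfolding Xe_def Xo_def s r' M[symmetric]
        unfolding eqs(1,3) by (simp add: divide_simps; simp add: algebra_simps)
      finally have a0: "?a i - ?a 0 = \<dots>" .
      have "?a i - ?a d = 2 * h * (s - 1 - n) + Xo n - Xe (n + 1) - (2 * h * m + Xe m)"
        using diag(2) diag(3)[OF i] val(2)[of i] val(1)[of d] False i d
        by (simp add: n_def m_def add.commute[of 1])
      also have "\<dots> = - h * e * (n + m + 1 + 2 * r) / M1"
        using nz' unfolding Xe_def Xo_def s r' M[symmetric]
        unfolding eqs(1) by (simp add: divide_simps; simp add: algebra_simps)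
      finally have ad: "?a i - ?a d = \<dots>" .
      have \<theta>s0: "\<theta>s i - \<theta>s 0 = - 2 * hs * (n + 1 + 2 * r)"
        using val(4)[of i] False i by (simp add: n_def algebra_simps)
      have \<theta>sd: "\<theta>s i - \<theta>s d = - 2 * hs * (n + m + 1 + 2 * r)"
        using val(4)[of i] val(3)[of d] False i d by (simp add: n_def m_def algebra_simps)
      show ?thesis
        unfolding a0 ad \<theta>s0 \<theta>sd m_def[symmetric] comm by (rule balance) (use nz' in auto)
    qed
  qed
qed

text \<open>Now the cancellation happens for odd \<open>i\<close>, so the end contribution with a
  denominator is the one at the even index \<open>d\<close> instead of \<open>1\<close>. This is why
  \<open>m + r\<close> takes over the role of \<open>1 + r\<close>.\<close>

lemma bannai_ito_even_balanced_2:
  fixes h hs s r r' :: "'a::field"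
  assumes d: "d > 0" "even d"
    and distinct: "\<And>i. i \<in> {1..d} \<Longrightarrow> \<theta>s i \<noteq> \<theta>s (i - 1)"
    and sum: "r + r' = - s - (- 2 * r) + of_nat d + 1"
    and \<theta>: "\<And>i. i \<le> d \<Longrightarrow> \<theta> i = \<theta> 0 + h * (s - 1 + (1 - s + 2 * of_nat i) * (- 1) ^ i)"
    and \<theta>s: "\<And>i. i \<le> d \<Longrightarrow>
      \<theta>s i = \<theta>s 0 + hs * (- 2 * r - 1 + (1 - (- 2 * r) + 2 * of_nat i) * (- 1) ^ i)"
    and \<phi>_even: "\<And>i. i \<in> {1..d} \<Longrightarrow> even i \<Longrightarrow> \<phi> i = - 4 * h * hs * of_nat i * (of_nat i + r')"
    and \<phi>_odd: "\<And>i. i \<in> {1..d} \<Longrightarrow> odd i \<Longrightarrow> \<phi> i = - 4 * h * hs * (of_nat i - of_nat d - 1) * (of_nat i + r)"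
  shows "balanced_weights d \<theta>s (split_diagonal d \<theta> \<theta>s \<phi>) r (r + of_nat d)"
proof -
  note \<theta>s_diff = alternating_diff[where \<theta>s = \<theta>s, OF \<theta>s]
  have nz: "hs \<noteq> 0" "(4::'a) \<noteq> 0" "of_nat i + r \<noteq> 0" if "i \<in> {1..d}" for i
    using distinct[OF that] \<theta>s_diff[OF _ that] by (auto split: if_splits)
  define m :: 'a where "m = of_nat d"
  define e where "e = r' - r"
  have s: "s = m + 1 - e" using sum by (simp add: e_def m_def algebra_simps)
  have r': "r' = r + e" by (simp add: e_def)
  define Xe Xo where "Xe n = - h * n * (n + r') / (n + r)" and "Xo n = h * (n - m - 1)" for n
  have X: "\<forall>i\<in>{1..d}. \<phi> i / (\<theta>s i - \<theta>s (i - 1)) = (if even i then Xe (of_nat i) else Xo (of_nat i))"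
  proof
    fix i assume i: "i \<in> {1..d}"
    have cancel: "- 4 * h * hs * a * c / (4 * hs * b) = - h * a * c / b"
        "- 4 * h * hs * a * b / (- 4 * hs * b) = h * a"
      if "b \<noteq> 0" for a b c
      using that nz(1,2)[OF i] by simp_all
    show "\<phi> i / (\<theta>s i - \<theta>s (i - 1)) = (if even i then Xe (of_nat i) else Xo (of_nat i))"
    proof (cases "even i")
      case True
      have diff: "\<theta>s i - \<theta>s (i - 1) = 4 * hs * (of_nat i + r)"
        using \<theta>s_diff[OF _ i] True by simp
      have "\<phi> i / (\<theta>s i - \<theta>s (i - 1)) = Xe (of_nat i)"
        unfolding \<phi>_even[OF i True] diff Xe_def m_def by (rule cancel[OF nz(3)[OF i]])
      then show ?thesis using True by simp
    next
      case False
      have diff: "\<theta>s i - \<theta>s (i - 1) = - 4 * hs * (of_nat i + r)"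
        using \<theta>s_diff[OF _ i] False by simp
      have "\<phi> i / (\<theta>s i - \<theta>s (i - 1)) = Xo (of_nat i)"
        unfolding \<phi>_odd[OF i False] diff Xo_def m_def by (rule cancel[OF nz(3)[OF i]])
      then show ?thesis using False by simp
    qed
  qed
  note diag = split_diagonal_eq[where \<theta> = \<theta>, OF d(1) X]
  note val = alternating_sequence[where f = \<theta>, OF \<theta>] alternating_sequence[where f = \<theta>s, OF \<theta>s]
  show ?thesis
  proof (rule balanced_weightsI)
    fix i assume i: "0 < i" "i < d"
    let ?a = "split_diagonal d \<theta> \<theta>s \<phi>"
    define n :: 'a where "n = of_nat i"
    define M1 M2 M4 where "M1 = n + r" and "M2 = n + 1 + r" and "M4 = m + r"
    note M = M1_def M2_def M4_def
    have nz': "M1 \<noteq> 0" "M2 \<noteq> 0" "M4 \<noteq> 0"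
      using nz(3)[of i] nz(3)[of "Suc i"] nz(3)[of d] i d
      by (auto simp: M n_def m_def add.commute[of 1])
    have eqs: "n = M1 - r" "n = M2 - 1 - r" "m = M4 - r"
      by (simp_all add: M)
    have comm: "r + m = M4" by (simp add: M)
    have balance: "r * (- h * e * y / M) * (c * p) = M4 * (- h * e * r * p / (M * M4)) * (c * y)"
      if "M \<noteq> 0" for M c p y k
      using that nz'(3) by simp
    show "r * (?a i - ?a 0) * (\<theta>s i - \<theta>s d) =
        (r + of_nat d) * (?a i - ?a d) * (\<theta>s i - \<theta>s 0)"
    proof (cases "even i")
      case True
      have "?a i - ?a 0 = 2 * h * n + Xe n - Xo (n + 1) + Xo 1"
        using diag(1) diag(3)[OF i] val(1)[of i] True i
        by (simp add: n_def add.commute[of 1])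
      also have "\<dots> = - h * e * n / M1"
        using nz' unfolding Xe_def Xo_def s r' M[symmetric]
        unfolding eqs(1) by (simp add: divide_simps; simp add: algebra_simps)
      finally have a0: "?a i - ?a 0 = \<dots>" .
      have "?a i - ?a d = 2 * h * n + Xe n - Xo (n + 1) - (2 * h * m + Xe m)"
        using diag(2) diag(3)[OF i] val(1)[of i] val(1)[of d] True i d
        by (simp add: n_def m_def add.commute[of 1])
      also have "\<dots> = - h * e * r * (n - m) / (M1 * M4)"
        using nz' unfolding Xe_def Xo_def s r' M[symmetric]
        unfolding eqs(1,3) by (simp add: divide_simps; simp add: algebra_simps)
      finally have ad: "?a i - ?a d = \<dots>" .
      have \<theta>s0: "\<theta>s i - \<theta>s 0 = 2 * hs * n"
        using val(3)[of i] True i by (simp add: n_def)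
      have \<theta>sd: "\<theta>s i - \<theta>s d = 2 * hs * (n - m)"
        using val(3)[of i] val(3)[of d] True i d by (simp add: n_def m_def algebra_simps)
      show ?thesis
        unfolding a0 ad \<theta>s0 \<theta>sd m_def[symmetric] comm by (rule balance) (use nz' in auto)
    next
      case False
      have "?a i - ?a 0 = 2 * h * (s - 1 - n) + Xo n - Xe (n + 1) + Xo 1"
        using diag(1) diag(3)[OF i] val(2)[of i] False i
        by (simp add: n_def add.commute[of 1])
      also have "\<dots> = - h * e * (n + 1 + 2 * r) / M2"
        using nz' unfolding Xe_def Xo_def s r' M[symmetric]
        unfolding eqs(2) by (simp add: divide_simps; simp add: algebra_simps)
      finally have a0: "?a i - ?a 0 = \<dots>" .
      have "?a i - ?a d = 2 * h * (s - 1 - n) + Xo n - Xe (n + 1) - (2 * h * m + Xe m)"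
        using diag(2) diag(3)[OF i] val(2)[of i] val(1)[of d] False i d
        by (simp add: n_def m_def add.commute[of 1])
      also have "\<dots> = - h * e * r * (n + m + 1 + 2 * r) / (M2 * M4)"
        using nz' unfolding Xe_def Xo_def s r' M[symmetric]
        unfolding eqs(2,3) by (simp add: divide_simps; simp add: algebra_simps)
      finally have ad: "?a i - ?a d = \<dots>" .
      have \<theta>s0: "\<theta>s i - \<theta>s 0 = - 2 * hs * (n + 1 + 2 * r)"
        using val(4)[of i] False i by (simp add: n_def algebra_simps)
      have \<theta>sd: "\<theta>s i - \<theta>s d = - 2 * hs * (n + m + 1 + 2 * r)"
        using val(4)[of i] val(3)[of d] False i d by (simp add: n_def m_def algebra_simps)
      show ?thesis
        unfolding a0 ad \<theta>s0 \<theta>sd m_def[symmetric] comm by (rule balance) (use nz' in auto)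
    qed
  qed
qed

text \<open>\<open>1\<close> and \<open>d\<close> are both odd, and for odd indices the denominator
  cancels, so the end entries are polynomial and \<open>e\<close> drops out of the differences.
  These now carry opposite signs, whence the negative weight. \<open>\<phi>_odd\<close> is symmetric
  in \<open>r\<close> and \<open>r'\<close>, so this serves \<open>r1\<close> and \<open>r2\<close>
  alike.\<close>

lemma bannai_ito_odd_balanced:
  fixes h hs s r r' :: "'a::field"
  assumes d: "d > 0" "odd d"
    and distinct: "\<And>i. i \<in> {1..d} \<Longrightarrow> \<theta>s i \<noteq> \<theta>s (i - 1)"
    and sum: "r + r' = - s - (- 2 * r) + of_nat d + 1"
    and \<theta>: "\<And>i. i \<le> d \<Longrightarrow> \<theta> i = \<theta> 0 + h * (s - 1 + (1 - s + 2 * of_nat i) * (- 1) ^ i)"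
    and \<theta>s: "\<And>i. i \<le> d \<Longrightarrow>
      \<theta>s i = \<theta>s 0 + hs * (- 2 * r - 1 + (1 - (- 2 * r) + 2 * of_nat i) * (- 1) ^ i)"
    and \<phi>_even: "\<And>i. i \<in> {1..d} \<Longrightarrow> even i \<Longrightarrow> \<phi> i = - 4 * h * hs * of_nat i * (of_nat i - of_nat d - 1)"
    and \<phi>_odd: "\<And>i. i \<in> {1..d} \<Longrightarrow> odd i \<Longrightarrow> \<phi> i = - 4 * h * hs * (of_nat i + r) * (of_nat i + r')"
  shows "balanced_weights d \<theta>s (split_diagonal d \<theta> \<theta>s \<phi>) r (- (r + of_nat d + 1))"
proof -
  note \<theta>s_diff = alternating_diff[where \<theta>s = \<theta>s, OF \<theta>s]
  have nz: "hs \<noteq> 0" "(4::'a) \<noteq> 0" "of_nat i + r \<noteq> 0" if "i \<in> {1..d}" for i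
    using distinct[OF that] \<theta>s_diff[OF _ that] by (auto split: if_splits)
  define m :: 'a where "m = of_nat d"
  define e where "e = r' - r"
  have s: "s = m + 1 - e" using sum by (simp add: e_def m_def algebra_simps)
  have r': "r' = r + e" by (simp add: e_def)
  define Xe Xo where "Xe n = - h * n * (n - m - 1) / (n + r)" and "Xo n = h * (n + r')" for n
  have X: "\<forall>i\<in>{1..d}. \<phi> i / (\<theta>s i - \<theta>s (i - 1)) = (if even i then Xe (of_nat i) else Xo (of_nat i))"
  proof
    fix i assume i: "i \<in> {1..d}"
    have cancel: "- 4 * h * hs * a * c / (4 * hs * b) = - h * a * c / b"
        "- 4 * h * hs * b * c / (- 4 * hs * b) = h * c"
      if "b \<noteq> 0" for a b c
      using that nz(1,2)[OF i] by simp_all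
    show "\<phi> i / (\<theta>s i - \<theta>s (i - 1)) = (if even i then Xe (of_nat i) else Xo (of_nat i))"
    proof (cases "even i")
      case True
      have diff: "\<theta>s i - \<theta>s (i - 1) = 4 * hs * (of_nat i + r)"
        using \<theta>s_diff[OF _ i] True by simp
      have "\<phi> i / (\<theta>s i - \<theta>s (i - 1)) = Xe (of_nat i)"
        unfolding \<phi>_even[OF i True] diff Xe_def m_def by (rule cancel[OF nz(3)[OF i]])
      then show ?thesis using True by simp
    next
      case False
      have diff: "\<theta>s i - \<theta>s (i - 1) = - 4 * hs * (of_nat i + r)"
        using \<theta>s_diff[OF _ i] False by simp
      have "\<phi> i / (\<theta>s i - \<theta>s (i - 1)) = Xo (of_nat i)"
        unfolding \<phi>_odd[OF i False] diff Xo_def m_def by (rule cancel[OF nz(3)[OF i]])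
      then show ?thesis using False by simp
    qed
  qed
  note diag = split_diagonal_eq[where \<theta> = \<theta>, OF d(1) X]
  note val = alternating_sequence[where f = \<theta>, OF \<theta>] alternating_sequence[where f = \<theta>s, OF \<theta>s]
  show ?thesis
  proof (rule balanced_weightsI)
    fix i assume i: "0 < i" "i < d"
    let ?a = "split_diagonal d \<theta> \<theta>s \<phi>"
    define n :: 'a where "n = of_nat i"
    define M1 M2 where "M1 = n + r" and "M2 = n + 1 + r"
    note M = M1_def M2_def
    have nz': "M1 \<noteq> 0" "M2 \<noteq> 0"
      using nz(3)[of i] nz(3)[of "Suc i"] i d
      by (auto simp: M n_def m_def add.commute[of 1])
    have eqs: "n = M1 - r" "n = M2 - 1 - r"
      by (simp_all add: M)
    have balance: "r * (h * y * k / M) * (c * p) = - k * (- h * r * p / M) * (c * y)"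
      if "M \<noteq> 0" for M c p y k
      using that by simp
    show "r * (?a i - ?a 0) * (\<theta>s i - \<theta>s d) =
        (- (r + of_nat d + 1)) * (?a i - ?a d) * (\<theta>s i - \<theta>s 0)"
    proof (cases "even i")
      case True
      have "?a i - ?a 0 = 2 * h * n + Xe n - Xo (n + 1) + Xo 1"
        using diag(1) diag(3)[OF i] val(1)[of i] True i
        by (simp add: n_def add.commute[of 1])
      also have "\<dots> = h * n * (r + m + 1) / M1"
        using nz' unfolding Xe_def Xo_def s r' M[symmetric]
        unfolding eqs(1) by (simp add: divide_simps; simp add: algebra_simps)
      finally have a0: "?a i - ?a 0 = \<dots>" .
      have "?a i - ?a d = 2 * h * n + Xe n - Xo (n + 1) - (2 * h * (s - 1 - m) + Xo m)"
        using diag(2) diag(3)[OF i] val(1)[of i] val(2)[of d] True i d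
        by (simp add: n_def m_def add.commute[of 1])
      also have "\<dots> = - h * r * (n + m + 1 + 2 * r) / M1"
        using nz' unfolding Xe_def Xo_def s r' M[symmetric]
        unfolding eqs(1) by (simp add: divide_simps; simp add: algebra_simps)
      finally have ad: "?a i - ?a d = \<dots>" .
      have \<theta>s0: "\<theta>s i - \<theta>s 0 = 2 * hs * n"
        using val(3)[of i] True i by (simp add: n_def)
      have \<theta>sd: "\<theta>s i - \<theta>s d = 2 * hs * (n + m + 1 + 2 * r)"
        using val(3)[of i] val(4)[of d] True i d by (simp add: n_def m_def algebra_simps)
      show ?thesis
        unfolding a0 ad \<theta>s0 \<theta>sd m_def[symmetric] by (rule balance) (use nz' in auto)
    next
      case False
      have "?a i - ?a 0 = 2 * h * (s - 1 - n) + Xo n - Xe (n + 1) + Xo 1"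
        using diag(1) diag(3)[OF i] val(2)[of i] False i
        by (simp add: n_def add.commute[of 1])
      also have "\<dots> = h * (n + 1 + 2 * r) * (r + m + 1) / M2"
        using nz' unfolding Xe_def Xo_def s r' M[symmetric]
        unfolding eqs(2) by (simp add: divide_simps; simp add: algebra_simps)
      finally have a0: "?a i - ?a 0 = \<dots>" .
      have "?a i - ?a d = 2 * h * (s - 1 - n) + Xo n - Xe (n + 1) - (2 * h * (s - 1 - m) + Xo m)"
        using diag(2) diag(3)[OF i] val(2)[of i] val(2)[of d] False i d
        by (simp add: n_def m_def add.commute[of 1])
      also have "\<dots> = - h * r * (n - m) / M2"
        using nz' unfolding Xe_def Xo_def s r' M[symmetric]
        unfolding eqs(2) by (simp add: divide_simps; simp add: algebra_simps)
      finally have ad: "?a i - ?a d = \<dots>" .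
      have \<theta>s0: "\<theta>s i - \<theta>s 0 = - 2 * hs * (n + 1 + 2 * r)"
        using val(4)[of i] False i by (simp add: n_def algebra_simps)
      have \<theta>sd: "\<theta>s i - \<theta>s d = - 2 * hs * (n - m)"
        using False i d by (simp add: val(4) n_def m_def algebra_simps)
      show ?thesis
        unfolding a0 ad \<theta>s0 \<theta>sd m_def[symmetric] by (rule balance) (use nz' in auto)
    qed
  qed
qed

section \<open>Weights for each type\<close>

text \<open>A factor \<open>w * q ^ i + 1\<close> with \<open>1 \<le> i \<le> d\<close> cannot
  vanish, since squaring would give \<open>w ^ 2 * q ^ (2 * i) = 1\<close>. So both weights vanish
  only if \<open>w = - 1\<close> and \<open>q ^ (d + 1) = 1\<close>, which contradicts the exclusion
  at the exponent \<open>d + 1\<close>.\<close>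

lemma q_weights_nonzero:
  fixes q w :: "'a::field"
  assumes "d > 0" "q \<noteq> 0" and ne: "\<forall>i\<in>{2..2 * d}. w ^ 2 * q ^ i \<noteq> 1"
  shows "q ^ d * (w + 1) * (w * q + 1) \<noteq> 0 \<or> (w * q ^ d + 1) * (w * q ^ (d + 1) + 1) \<noteq> 0"
proof (rule ccontr)
  have square: "w * q ^ i + 1 \<noteq> 0" if "i \<in> {1..d}" for i
  proof
    assume "w * q ^ i + 1 = 0"
    then have "w * q ^ i = - 1" by (simp add: eq_neg_iff_add_eq_0)
    then have "(w * q ^ i) ^ 2 = 1" by simp
    then have "w ^ 2 * q ^ (2 * i) = 1"
      by (simp add: power_mult_distrib power_mult[symmetric] mult.commute)
    moreover have "2 * i \<in> {2..2 * d}" using that by auto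
    ultimately show False using ne by blast
  qed
  assume "\<not> ?thesis"
  then have "w + 1 = 0" "w * q ^ (d + 1) + 1 = 0"
    using square[of 1] square[of d] assms(1,2) by auto
  then have "w = - 1" "q ^ (d + 1) = 1" by (simp_all add: eq_neg_iff_add_eq_0[symmetric])
  then have "w ^ 2 * q ^ (d + 1) = 1" by simp
  moreover have "d + 1 \<in> {2..2 * d}" using assms(1) by auto
  ultimately show False using ne by blast
qed

lemma q_racah_type_commute:
  "q_racah_type d \<theta> \<theta>s \<phi>1 \<phi>2 q h hs s ss r1 r2 \<longleftrightarrow> q_racah_type d \<theta> \<theta>s \<phi>1 \<phi>2 q h hs s ss r2 r1"
  unfolding q_racah_type_def by (simp only: mult_ac conj_ac)

lemma racah_type_commute:
  "racah_type d \<theta> \<theta>s \<phi>1 \<phi>2 h hs s ss r1 r2 \<longleftrightarrow> racah_type d \<theta> \<theta>s \<phi>1 \<phi>2 h hs s ss r2 r1"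
  unfolding racah_type_def by (simp only: mult_ac add_ac conj_ac)

lemma bannai_ito_typeD:
  fixes r1 r2 :: "'a::field"
  assumes "bannai_ito_type d \<theta> \<theta>s \<phi>1 \<phi>2 h hs s ss r1 r2"
  shows "CHAR('a) = 0 \<or> prime CHAR('a) \<and> odd CHAR('a) \<and> d < 2 * CHAR('a)"
    and "r1 + r2 = - s - ss + of_nat d + 1"
    and "i \<in> {1..d} \<Longrightarrow> ss \<noteq> 2 * of_nat i"
    and "i \<le> d \<Longrightarrow> \<theta> i = \<theta> 0 + h * (s - 1 + (1 - s + 2 * of_nat i) * (- 1) ^ i)"
    and "i \<le> d \<Longrightarrow> \<theta>s i = \<theta>s 0 + hs * (ss - 1 + (1 - ss + 2 * of_nat i) * (- 1) ^ i)"
    and "even d \<Longrightarrow> i \<in> {1..d} \<Longrightarrow> even i \<Longrightarrow> \<phi>1 i = - 4 * h * hs * of_nat i * (of_nat i + r1)"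
    and "even d \<Longrightarrow> i \<in> {1..d} \<Longrightarrow> odd i \<Longrightarrow>
      \<phi>1 i = - 4 * h * hs * (of_nat i - of_nat d - 1) * (of_nat i + r2)"
    and "odd d \<Longrightarrow> i \<in> {1..d} \<Longrightarrow> even i \<Longrightarrow>
      \<phi>1 i = - 4 * h * hs * of_nat i * (of_nat i - of_nat d - 1)"
    and "odd d \<Longrightarrow> i \<in> {1..d} \<Longrightarrow> odd i \<Longrightarrow>
      \<phi>1 i = - 4 * h * hs * (of_nat i + r1) * (of_nat i + r2)"
proof -
  note t3 = assms[unfolded bannai_ito_type_def, THEN conjunct2, THEN conjunct2]
  note t4 = t3[THEN conjunct2]
  note t7 = t4[THEN conjunct2, THEN conjunct2, THEN conjunct2]
  note t8 = t7[THEN conjunct2]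
  note t9 = t8[THEN conjunct2]
  note t10 = t9[THEN conjunct2]
  show "CHAR('a) = 0 \<or> prime CHAR('a) \<and> odd CHAR('a) \<and> d < 2 * CHAR('a)"
    by (rule t3[THEN conjunct1])
  show "r1 + r2 = - s - ss + of_nat d + 1" by (rule t4[THEN conjunct1])
  show "ss \<noteq> 2 * of_nat i" if "i \<in> {1..d}" using t7[THEN conjunct1] that by blast
  show "\<theta> i = \<theta> 0 + h * (s - 1 + (1 - s + 2 * of_nat i) * (- 1) ^ i)" if "i \<le> d"
    using t8[THEN conjunct1] that by blast
  show "\<theta>s i = \<theta>s 0 + hs * (ss - 1 + (1 - ss + 2 * of_nat i) * (- 1) ^ i)" if "i \<le> d"
    using t9[THEN conjunct1] that by blast
  note even = t10[THEN conjunct1, THEN mp] and odd = t10[THEN conjunct2, THEN mp]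
  show "\<phi>1 i = - 4 * h * hs * of_nat i * (of_nat i + r1)" if "even d" "i \<in> {1..d}" "even i"
    using even[OF that(1), THEN conjunct1] that by blast
  show "\<phi>1 i = - 4 * h * hs * (of_nat i - of_nat d - 1) * (of_nat i + r2)"
    if "even d" "i \<in> {1..d}" "odd i"
    using even[OF that(1), THEN conjunct2] that by blast
  show "\<phi>1 i = - 4 * h * hs * of_nat i * (of_nat i - of_nat d - 1)"
    if "odd d" "i \<in> {1..d}" "even i"
    using odd[OF that(1), THEN conjunct1] that by blast
  show "\<phi>1 i = - 4 * h * hs * (of_nat i + r1) * (of_nat i + r2)" if "odd d" "i \<in> {1..d}" "odd i"
    using odd[OF that(1), THEN conjunct2] that by blast
qed

context
  fixes d :: nat and \<theta>s :: "nat \<Rightarrow> 'a::field"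
  assumes d: "d \<ge> 3" and inj: "inj_on \<theta>s {..d}"
begin

lemma dual_eigenvalues_consecutive: "\<theta>s i \<noteq> \<theta>s (i - 1)" if "i \<in> {1..d}" for i
  by (rule inj_on_contraD[OF inj]) (use that in auto)

lemma diameter_pos: "d > 0"
  using d by simp

lemma q_racah_weights:
  assumes type: "q_racah_type d \<theta> \<theta>s \<phi>1 \<phi>2 q h hs s (r1 ^ 2) r1 r2"
  shows "balanced_weights d \<theta>s (split_diagonal d \<theta> \<theta>s \<phi>1)
      (q ^ d * (r1 + 1) * (r1 * q + 1)) ((r1 * q ^ d + 1) * (r1 * q ^ (d + 1) + 1))"
    and "q ^ d * (r1 + 1) * (r1 * q + 1) \<noteq> 0 \<or> (r1 * q ^ d + 1) * (r1 * q ^ (d + 1) + 1) \<noteq> 0"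
proof -
  have "r1 * r2 = s * r1 ^ 2 * q ^ (d + 1)" "r1 \<noteq> 0" and q: "q \<noteq> 0"
    and ne: "\<forall>i\<in>{2..2 * d}. r1 ^ 2 * q ^ i \<noteq> 1"
    using type unfolding q_racah_type_def by blast+
  then have "r1 * r2 = r1 * (s * r1 * q ^ (d + 1))" by (simp only: power2_eq_square mult_ac)
  with \<open>r1 \<noteq> 0\<close> have r2: "r2 = s * r1 * q ^ (d + 1)" by (metis mult_left_cancel)
  show "balanced_weights d \<theta>s (split_diagonal d \<theta> \<theta>s \<phi>1)
      (q ^ d * (r1 + 1) * (r1 * q + 1)) ((r1 * q ^ d + 1) * (r1 * q ^ (d + 1) + 1))"
    by (rule q_balanced[where \<theta> = \<theta> and \<theta>s = \<theta>s and \<phi> = \<phi>1 and h = h and hs = hs and s = s])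
      (use diameter_pos dual_eigenvalues_consecutive type[unfolded q_racah_type_def r2] in blast)+
  show "q ^ d * (r1 + 1) * (r1 * q + 1) \<noteq> 0 \<or> (r1 * q ^ d + 1) * (r1 * q ^ (d + 1) + 1) \<noteq> 0"
    by (rule q_weights_nonzero[OF diameter_pos q ne])
qed

lemma q_hahn_weights:
  assumes type: "q_hahn_type d \<theta> \<theta>s \<phi>1 \<phi>2 q h hs (r ^ 2) r"
  shows "balanced_weights d \<theta>s (split_diagonal d \<theta> \<theta>s \<phi>1)
      (q ^ d * (r + 1) * (r * q + 1)) ((r * q ^ d + 1) * (r * q ^ (d + 1) + 1))"
    and "q ^ d * (r + 1) * (r * q + 1) \<noteq> 0 \<or> (r * q ^ d + 1) * (r * q ^ (d + 1) + 1) \<noteq> 0"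
proof -
  have q: "q \<noteq> 0" and ne: "\<forall>i\<in>{2..2 * d}. r ^ 2 * q ^ i \<noteq> 1"
    and \<theta>: "\<And>i. i \<le> d \<Longrightarrow> \<theta> i = \<theta> 0 + h * (1 - q ^ i) * q powi (- int i)"
    and \<theta>s: "\<And>i. i \<le> d \<Longrightarrow>
      \<theta>s i = \<theta>s 0 + hs * (1 - q ^ i) * (1 - r ^ 2 * q ^ (i + 1)) * q powi (- int i)"
    and \<phi>: "\<And>i. i \<in> {1..d} \<Longrightarrow> \<phi>1 i = h * hs * q powi (1 - 2 * int i) * (1 - q ^ i) *
        (1 - q powi (int i - int d - 1)) * (1 - r * q ^ i)"
  proof -
    \<comment> \<open>The conjuncts are selected by hand: the conjunct for \<open>\<theta> i\<close> mentions \<open>\<theta> 0\<close> and makes automation loop.\<close>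
    note t5 = type[unfolded q_hahn_type_def, THEN conjunct2, THEN conjunct2, THEN conjunct2, THEN conjunct2]
    note t7 = t5[THEN conjunct2, THEN conjunct2]
    note t8 = t7[THEN conjunct2]
    note t9 = t8[THEN conjunct2]
    note t10 = t9[THEN conjunct2]
    show "q \<noteq> 0" by (rule type[unfolded q_hahn_type_def, THEN conjunct1])
    show "\<forall>i\<in>{2..2 * d}. r ^ 2 * q ^ i \<noteq> 1" by (rule t7[THEN conjunct1])
    show "\<theta> i = \<theta> 0 + h * (1 - q ^ i) * q powi (- int i)" if "i \<le> d" for i
      using t8[THEN conjunct1] that by blast
    show "\<theta>s i = \<theta>s 0 + hs * (1 - q ^ i) * (1 - r ^ 2 * q ^ (i + 1)) * q powi (- int i)"
      if "i \<le> d" for i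
      using t9[THEN conjunct1] that by blast
    show "\<phi>1 i = h * hs * q powi (1 - 2 * int i) * (1 - q ^ i) *
        (1 - q powi (int i - int d - 1)) * (1 - r * q ^ i)" if "i \<in> {1..d}" for i
      using t10[THEN conjunct1] that by blast
  qed
  have \<theta>': "\<theta> i = \<theta> 0 + h * (1 - q ^ i) * (1 - 0 * q ^ (i + 1)) * q powi (- int i)" if "i \<le> d" for i
    by (simp add: \<theta>[OF that])
  have \<phi>': "\<phi>1 i = h * hs * q powi (1 - 2 * int i) * (1 - q ^ i) *
      (1 - q powi (int i - int d - 1)) * (1 - r * q ^ i) * (1 - 0 * r * q ^ (d + 1) * q ^ i)"
    if "i \<in> {1..d}" for i
    by (simp add: \<phi>[OF that])
  show "balanced_weights d \<theta>s (split_diagonal d \<theta> \<theta>s \<phi>1)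
      (q ^ d * (r + 1) * (r * q + 1)) ((r * q ^ d + 1) * (r * q ^ (d + 1) + 1))"
    by (rule q_balanced[where \<theta> = \<theta> and \<theta>s = \<theta>s and \<phi> = \<phi>1 and h = h and hs = hs and s = 0])
      (use diameter_pos dual_eigenvalues_consecutive q \<theta>' \<theta>s \<phi>' in blast)+
  show "q ^ d * (r + 1) * (r * q + 1) \<noteq> 0 \<or> (r * q ^ d + 1) * (r * q ^ (d + 1) + 1) \<noteq> 0"
    by (rule q_weights_nonzero[OF diameter_pos q ne])
qed

lemma dual_q_krawtchouk_weights:
  assumes type: "dual_q_krawtchouk_type d \<theta> \<theta>s \<phi>1 \<phi>2 q h hs s"
  shows "balanced_weights d \<theta>s (split_diagonal d \<theta> \<theta>s \<phi>1) (q ^ d) 1"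
proof -
  have q: "q \<noteq> 0"
    and \<theta>: "\<And>i. i \<le> d \<Longrightarrow> \<theta> i = \<theta> 0 + h * (1 - q ^ i) * (1 - s * q ^ (i + 1)) * q powi (- int i)"
    and \<theta>s: "\<And>i. i \<le> d \<Longrightarrow> \<theta>s i = \<theta>s 0 + hs * (1 - q ^ i) * q powi (- int i)"
    and \<phi>: "\<And>i. i \<in> {1..d} \<Longrightarrow> \<phi>1 i = h * hs * q powi (1 - 2 * int i) * (1 - q ^ i) *
        (1 - q powi (int i - int d - 1))"
    using type unfolding dual_q_krawtchouk_type_def by blast+
  have \<theta>s': "\<theta>s i = \<theta>s 0 + hs * (1 - q ^ i) * (1 - 0 ^ 2 * q ^ (i + 1)) * q powi (- int i)"
    if "i \<le> d" for i
    by (simp add: \<theta>s[OF that])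
  have \<phi>': "\<phi>1 i = h * hs * q powi (1 - 2 * int i) * (1 - q ^ i) *
      (1 - q powi (int i - int d - 1)) * (1 - 0 * q ^ i) * (1 - s * 0 * q ^ (d + 1) * q ^ i)"
    if "i \<in> {1..d}" for i
    by (simp add: \<phi>[OF that])
  have "balanced_weights d \<theta>s (split_diagonal d \<theta> \<theta>s \<phi>1)
      (q ^ d * (0 + 1) * (0 * q + 1)) ((0 * q ^ d + 1) * (0 * q ^ (d + 1) + 1))"
    by (rule q_balanced[where \<theta> = \<theta> and \<theta>s = \<theta>s and \<phi> = \<phi>1 and h = h and hs = hs and s = s])
      (use diameter_pos dual_eigenvalues_consecutive q \<theta> \<theta>s' \<phi>' in blast)+
  then show ?thesis by simp
qed

lemma racah_weights:
  assumes type: "racah_type d \<theta> \<theta>s \<phi>1 \<phi>2 h hs s (2 * r1) r1 r2"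
  shows "balanced_weights d \<theta>s (split_diagonal d \<theta> \<theta>s \<phi>1) 1 1"
proof -
  have "r1 + r2 = s + 2 * r1 + of_nat d + 1" using type unfolding racah_type_def by blast
  then have r2: "r2 = s + r1 + of_nat d + 1" by (simp add: algebra_simps)
  show ?thesis
    by (rule racah_balanced[where \<theta> = \<theta> and \<theta>s = \<theta>s and \<phi> = \<phi>1 and h = h and hs = hs and s = s and r = r1])
      (use diameter_pos dual_eigenvalues_consecutive type[unfolded racah_type_def r2] in blast)+
qed

lemma hahn_weights:
  assumes type: "hahn_type d \<theta> \<theta>s \<phi>1 \<phi>2 hs s ss r"
  shows "balanced_weights d \<theta>s (split_diagonal d \<theta> \<theta>s \<phi>1)
      (ss * (ss + 2)) ((ss + 2 * of_nat d) * (ss + 2 * of_nat d + 2))"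
    and "ss * (ss + 2) \<noteq> 0 \<or> (ss + 2 * of_nat d) * (ss + 2 * of_nat d + 2) \<noteq> 0"
proof -
  show "balanced_weights d \<theta>s (split_diagonal d \<theta> \<theta>s \<phi>1)
      (ss * (ss + 2)) ((ss + 2 * of_nat d) * (ss + 2 * of_nat d + 2))"
    by (rule hahn_balanced[where \<theta> = \<theta> and \<theta>s = \<theta>s and \<phi> = \<phi>1 and hs = hs and s = s and r = r])
      (use diameter_pos dual_eigenvalues_consecutive type[unfolded hahn_type_def] in blast)+
  have ne: "ss + of_nat i \<noteq> 0" if "i \<in> {2..2 * d}" for i
    using type that unfolding hahn_type_def eq_neg_iff_add_eq_0 by blast
  have char: "CHAR('a) = 0 \<or> prime CHAR('a) \<and> d < CHAR('a)"
    using type unfolding hahn_type_def by blast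
  \<comment> \<open>If both vanish, the exclusions at \<open>2\<close> and \<open>2 * d\<close>
    leave \<open>ss = 0\<close> and \<open>2 * (d + 1) = 0\<close> in the field. The characteristic
    is then a prime above \<open>d\<close>, hence odd, so it divides \<open>d + 1\<close>, and
    \<open>ss = 0\<close> is the excluded value \<open>- of_nat (d + 1)\<close>.\<close>
  show "ss * (ss + 2) \<noteq> 0 \<or> (ss + 2 * of_nat d) * (ss + 2 * of_nat d + 2) \<noteq> 0"
  proof (rule ccontr)
    assume "\<not> ?thesis"
    then have "ss = 0" "ss + 2 * of_nat d + 2 = 0"
      using ne[of 2] ne[of "2 * d"] d by auto
    then have "of_nat (2 * (d + 1)) = (0::'a)" by (simp add: algebra_simps)
    then have dvd: "CHAR('a) dvd 2 * (d + 1)" by (simp only: of_nat_eq_0_iff_char_dvd)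
    then have "prime CHAR('a)" "d < CHAR('a)" using char by auto
    then have "CHAR('a) dvd d + 1"
      using dvd d prime_dvd_mult_iff[of "CHAR('a)" 2 "d + 1"] dvd_imp_le[of "CHAR('a)" 2] by auto
    then have "of_nat (d + 1) = (0::'a)" by (simp only: of_nat_eq_0_iff_char_dvd)
    then show False using ne[of "d + 1"] \<open>ss = 0\<close> d by simp
  qed
qed

lemma krawtchouk_weights:
  assumes type: "krawtchouk_type d \<theta> \<theta>s \<phi>1 \<phi>2 s ss r"
  shows "balanced_weights d \<theta>s (split_diagonal d \<theta> \<theta>s \<phi>1) 1 1"
  by (rule krawtchouk_balanced[where \<theta> = \<theta> and \<theta>s = \<theta>s and \<phi> = \<phi>1 and s = s and ss = ss and r = r])
    (use diameter_pos dual_eigenvalues_consecutive type[unfolded krawtchouk_type_def] in blast)+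

text \<open>For even \<open>d\<close> the two weights differ by \<open>of_nat d\<close>, so this
  keeps them from vanishing together. The characteristic could divide
  \<open>d < 2 * CHAR('a)\<close> only by being equal to it, but it is odd and \<open>d\<close> is
  even.\<close>

lemma bannai_ito_char_even:
  assumes "bannai_ito_type d \<theta> \<theta>s \<phi>1 \<phi>2 h hs s ss r1 r2" "even d"
  shows "of_nat d \<noteq> (0::'a)"
proof
  assume "of_nat d = (0::'a)"
  then have dvd: "CHAR('a) dvd d" by (simp only: of_nat_eq_0_iff_char_dvd)
  then obtain k where k: "d = CHAR('a) * k" by blast
  have "CHAR('a) \<noteq> 0" using dvd d by (intro notI) simp
  then have "odd CHAR('a)" "d < 2 * CHAR('a)"
    using bannai_ito_typeD(1)[OF assms(1)] by auto
  then have "k < 2" using k by (simp add: mult.commute)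
  then have "k = 0 \<or> k = 1" by auto
  then show False using k d \<open>odd CHAR('a)\<close> \<open>even d\<close> by auto
qed

text \<open>For odd \<open>d\<close> both weights vanish only if \<open>r = 0\<close>, hence
  \<open>ss = 0\<close>, and \<open>d + 1\<close> is zero in the field. An odd characteristic
  dividing the even number \<open>d + 1\<close> is at most \<open>d\<close>, and then the exclusion
  of \<open>2 * of_nat CHAR('a)\<close> is the exclusion of \<open>0\<close>.\<close>

lemma bannai_ito_char_odd:
  assumes "bannai_ito_type d \<theta> \<theta>s \<phi>1 \<phi>2 h hs s ss r1 r2" "odd d"
  shows "ss \<noteq> 0 \<or> of_nat d + 1 \<noteq> (0::'a)"
proof (rule ccontr)
  assume "\<not> ?thesis"
  then have ss: "ss = 0" and "of_nat (d + 1) = (0::'a)" by (auto simp: add.commute)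
  then have dvd: "CHAR('a) dvd d + 1" by (simp only: of_nat_eq_0_iff_char_dvd)
  then have "CHAR('a) \<noteq> 0" by (intro notI) simp
  then have char: "odd CHAR('a)" "d < 2 * CHAR('a)"
    using bannai_ito_typeD(1)[OF assms(1)] by auto
  have "CHAR('a) \<noteq> d + 1" using char(1) \<open>odd d\<close> by auto
  then have "CHAR('a) \<in> {1..d}" using dvd_imp_le[OF dvd] \<open>CHAR('a) \<noteq> 0\<close> by auto
  then have "ss \<noteq> 2 * of_nat CHAR('a)" using bannai_ito_typeD(3)[OF assms(1)] by blast
  then show False using ss by simp
qed

lemma bannai_ito_even_weights_1:
  assumes type: "bannai_ito_type d \<theta> \<theta>s \<phi>1 \<phi>2 h hs s (- 2 * r1) r1 r2" and "even d"
  shows "balanced_weights d \<theta>s (split_diagonal d \<theta> \<theta>s \<phi>1) (r1 + 1) (r1 + of_nat d + 1)"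
    and "r1 + 1 \<noteq> 0 \<or> r1 + of_nat d + 1 \<noteq> 0"
proof -
  note D = bannai_ito_typeD[OF type]
  show "balanced_weights d \<theta>s (split_diagonal d \<theta> \<theta>s \<phi>1) (r1 + 1) (r1 + of_nat d + 1)"
    by (rule bannai_ito_even_balanced_1[OF diameter_pos \<open>even d\<close> dual_eigenvalues_consecutive D(2) D(4,5)
          D(6)[OF \<open>even d\<close>] D(7)[OF \<open>even d\<close>]])
  show "r1 + 1 \<noteq> 0 \<or> r1 + of_nat d + 1 \<noteq> 0"
    using bannai_ito_char_even[OF assms] by (metis add.assoc add.commute add_0)
qed

lemma bannai_ito_even_weights_2:
  assumes type: "bannai_ito_type d \<theta> \<theta>s \<phi>1 \<phi>2 h hs s (- 2 * r2) r1 r2" and "even d"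
  shows "balanced_weights d \<theta>s (split_diagonal d \<theta> \<theta>s \<phi>1) r2 (r2 + of_nat d)"
    and "r2 \<noteq> 0 \<or> r2 + of_nat d \<noteq> 0"
proof -
  note D = bannai_ito_typeD[OF type]
  have "r1 + r2 = - s - (- 2 * r2) + of_nat d + 1"
    by (rule bannai_ito_typeD(2)[OF type])
  then have sum: "r2 + r1 = - s - (- 2 * r2) + of_nat d + 1"
    by (simp only: add.commute[of r1])
  show "balanced_weights d \<theta>s (split_diagonal d \<theta> \<theta>s \<phi>1) r2 (r2 + of_nat d)"
    by (rule bannai_ito_even_balanced_2[OF diameter_pos \<open>even d\<close> dual_eigenvalues_consecutive sum D(4,5)
          D(6)[OF \<open>even d\<close>] D(7)[OF \<open>even d\<close>]])
  show "r2 \<noteq> 0 \<or> r2 + of_nat d \<noteq> 0"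
    using bannai_ito_char_even[OF assms] by auto
qed

lemma bannai_ito_odd_weights_1:
  assumes type: "bannai_ito_type d \<theta> \<theta>s \<phi>1 \<phi>2 h hs s (- 2 * r1) r1 r2" and "odd d"
  shows "balanced_weights d \<theta>s (split_diagonal d \<theta> \<theta>s \<phi>1) r1 (- (r1 + of_nat d + 1))"
    and "r1 \<noteq> 0 \<or> - (r1 + of_nat d + 1) \<noteq> 0"
proof -
  note D = bannai_ito_typeD[OF type]
  show "balanced_weights d \<theta>s (split_diagonal d \<theta> \<theta>s \<phi>1) r1 (- (r1 + of_nat d + 1))"
    by (rule bannai_ito_odd_balanced[OF diameter_pos \<open>odd d\<close> dual_eigenvalues_consecutive D(2) D(4,5)
          D(8)[OF \<open>odd d\<close>] D(9)[OF \<open>odd d\<close>]])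
  show "r1 \<noteq> 0 \<or> - (r1 + of_nat d + 1) \<noteq> 0"
    unfolding neg_equal_0_iff_equal using bannai_ito_char_odd[OF assms] by (cases "r1 = 0") simp_all
qed

lemma bannai_ito_odd_weights_2:
  assumes type: "bannai_ito_type d \<theta> \<theta>s \<phi>1 \<phi>2 h hs s (- 2 * r2) r1 r2" and "odd d"
  shows "balanced_weights d \<theta>s (split_diagonal d \<theta> \<theta>s \<phi>1) r2 (- (r2 + of_nat d + 1))"
    and "r2 \<noteq> 0 \<or> - (r2 + of_nat d + 1) \<noteq> 0"
proof -
  note D = bannai_ito_typeD[OF type]
  have "r1 + r2 = - s - (- 2 * r2) + of_nat d + 1"
    by (rule bannai_ito_typeD(2)[OF type])
  then have sum: "r2 + r1 = - s - (- 2 * r2) + of_nat d + 1"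
    by (simp only: add.commute[of r1])
  have \<phi>_odd: "\<phi>1 i = - 4 * h * hs * (of_nat i + r2) * (of_nat i + r1)" if "i \<in> {1..d}" "odd i" for i
  proof -
    have "\<phi>1 i = - 4 * h * hs * (of_nat i + r1) * (of_nat i + r2)"
      by (rule bannai_ito_typeD(9)[OF type \<open>odd d\<close> that])
    then show ?thesis by (simp only: mult_ac)
  qed
  show "balanced_weights d \<theta>s (split_diagonal d \<theta> \<theta>s \<phi>1) r2 (- (r2 + of_nat d + 1))"
    by (rule bannai_ito_odd_balanced[OF diameter_pos \<open>odd d\<close> dual_eigenvalues_consecutive sum D(4,5)
          D(8)[OF \<open>odd d\<close>] \<phi>_odd])
  show "r2 \<noteq> 0 \<or> - (r2 + of_nat d + 1) \<noteq> 0"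
    unfolding neg_equal_0_iff_equal using bannai_ito_char_odd[OF assms] by (cases "r2 = 0") simp_all
qed

end

section \<open>Assembly of the twelve cases\<close>

theorem proposition12p1:
  fixes scale :: "'a::alg_closed_field \<Rightarrow> 'v::ab_group_add \<Rightarrow> 'v"
    and d :: nat
    and A As Xminus Xplus :: "'v \<Rightarrow> 'v"
    and E Es :: "nat \<Rightarrow> 'v \<Rightarrow> 'v"
    and \<theta> \<theta>s \<phi>1 \<phi>2 a :: "nat \<Rightarrow> 'a"
  assumes "vector_space scale"
    and "vector_space.dim scale (UNIV :: 'v set) = d + 1"
    and "d \<ge> 3"
    and "leonard_system scale d A E As Es"
    and "eigenvalue_sequence scale d A E \<theta>"
    and "eigenvalue_sequence scale d As Es \<theta>s"
    and "first_split_sequence scale d A E As Es \<phi>1"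
    and "second_split_sequence scale d A E As Es \<phi>2"
    and "\<And>i. i \<le> d \<Longrightarrow> a i = trace_op scale (Es i \<circ> A)"
    and "Xminus = (A - op_scale scale (a 0) id) \<circ> (As - op_scale scale (\<theta>s d) id)"
    and "Xplus = (A - op_scale scale (a d) id) \<circ> (As - op_scale scale (\<theta>s 0) id)"
    and "zero_diagonal_space scale d A As Es \<noteq> {0}"
  shows
    "let Z = zero_diagonal_space scale d A As Es;
         smul = op_scale scale;
         claim = (\<lambda>X. X \<noteq> 0 \<and> X \<in> Z \<and> (vector_space.dim smul Z = 1 \<longrightarrow> is_basis smul Z {X}))
     in
       (\<forall>q h hs s ss r1 r2. q_racah_type d \<theta> \<theta>s \<phi>1 \<phi>2 q h hs s ss r1 r2 \<and> ss = r1 ^ 2 \<longrightarrow>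
          claim (smul (q ^ d * (r1 + 1) * (r1 * q + 1)) Xminus
               - smul ((r1 * q ^ d + 1) * (r1 * q ^ (d + 1) + 1)) Xplus)) \<and>
       (\<forall>q h hs s ss r1 r2. q_racah_type d \<theta> \<theta>s \<phi>1 \<phi>2 q h hs s ss r1 r2 \<and> ss = r2 ^ 2 \<longrightarrow>
          claim (smul (q ^ d * (r2 + 1) * (r2 * q + 1)) Xminus
               - smul ((r2 * q ^ d + 1) * (r2 * q ^ (d + 1) + 1)) Xplus)) \<and>
       (\<forall>q h hs ss r. q_hahn_type d \<theta> \<theta>s \<phi>1 \<phi>2 q h hs ss r \<and> ss = r ^ 2 \<longrightarrow>
          claim (smul (q ^ d * (r + 1) * (r * q + 1)) Xminus
               - smul ((r * q ^ d + 1) * (r * q ^ (d + 1) + 1)) Xplus)) \<and>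
       (\<forall>q h hs s. dual_q_krawtchouk_type d \<theta> \<theta>s \<phi>1 \<phi>2 q h hs s \<longrightarrow>
          claim (smul (q ^ d) Xminus - Xplus)) \<and>
       (\<forall>h hs s ss r1 r2. racah_type d \<theta> \<theta>s \<phi>1 \<phi>2 h hs s ss r1 r2 \<and> ss = 2 * r1 \<longrightarrow>
          claim (Xminus - Xplus)) \<and>
       (\<forall>h hs s ss r1 r2. racah_type d \<theta> \<theta>s \<phi>1 \<phi>2 h hs s ss r1 r2 \<and> ss = 2 * r2 \<longrightarrow>
          claim (Xminus - Xplus)) \<and>
       (\<forall>hs s ss r. hahn_type d \<theta> \<theta>s \<phi>1 \<phi>2 hs s ss r \<longrightarrow>
          claim (smul (ss * (ss + 2)) Xminus
               - smul ((ss + 2 * of_nat d) * (ss + 2 * of_nat d + 2)) Xplus)) \<and>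
       (\<forall>s ss r. krawtchouk_type d \<theta> \<theta>s \<phi>1 \<phi>2 s ss r \<longrightarrow>
          claim (Xminus - Xplus)) \<and>
       (\<forall>h hs s ss r1 r2. even d \<and> bannai_ito_type d \<theta> \<theta>s \<phi>1 \<phi>2 h hs s ss r1 r2 \<and> ss = - 2 * r1 \<longrightarrow>
          claim (smul (r1 + 1) Xminus - smul (r1 + of_nat d + 1) Xplus)) \<and>
       (\<forall>h hs s ss r1 r2. even d \<and> bannai_ito_type d \<theta> \<theta>s \<phi>1 \<phi>2 h hs s ss r1 r2 \<and> ss = - 2 * r2 \<longrightarrow>
          claim (smul r2 Xminus - smul (r2 + of_nat d) Xplus)) \<and>
       (\<forall>h hs s ss r1 r2. odd d \<and> bannai_ito_type d \<theta> \<theta>s \<phi>1 \<phi>2 h hs s ss r1 r2 \<and> ss = - 2 * r1 \<longrightarrow>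
          claim (smul r1 Xminus + smul (r1 + of_nat d + 1) Xplus)) \<and>
       (\<forall>h hs s ss r1 r2. odd d \<and> bannai_ito_type d \<theta> \<theta>s \<phi>1 \<phi>2 h hs s ss r1 r2 \<and> ss = - 2 * r2 \<longrightarrow>
          claim (smul r2 Xminus + smul (r2 + of_nat d + 1) Xplus))"
proof -
  note ls = assms(4)
  obtain v where v: "\<And>i. i \<le> d \<Longrightarrow> As (v i) = scale (\<theta>s i) (v i)" "ordered_basis scale d v"
      "irreducible_tridiagonal d (matrix_wrt scale d v A)" and inj: "inj_on \<theta>s {..d}"
    using standard_eigenbasis[OF _ assms(6), of A] ls unfolding leonard_system_def by metis
  have A: "Vector_Spaces.linear scale scale A" and As: "Vector_Spaces.linear scale scale As"
    using ls by (auto simp: leonard_system_def leonard_pair_def)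
  have Es: "Es i x = scale (coord scale d v i x) (v i)" if "i \<le> d" for i x
    using vector_space.primitive_idempotent_coord[OF assms(1) v(2) v(1) inj that] assms(6) that
    by (simp add: eigenvalue_sequence_def)
  have a: "a i = coord scale d v i (A (v i))" if "i \<le> d" for i
    using vector_space.trace_rank_one[OF assms(1) v(2) A Es[OF that]] assms(9)[OF that] by simp
  have a_split: "a i = split_diagonal d \<theta> \<theta>s \<phi>1 i" if "i \<le> d" for i
    using leonard_diagonal_eq_split_diagonal[OF assms(1) ls assms(5-7) v inj that] a[OF that] by simp
  define Z where "Z = zero_diagonal_space scale d A As Es"
  define smul :: "'a \<Rightarrow> ('v \<Rightarrow> 'v) \<Rightarrow> 'v \<Rightarrow> 'v" where "smul = op_scale scale"
  define claim where "claim X \<longleftrightarrow>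
    X \<noteq> 0 \<and> X \<in> Z \<and> (vector_space.dim smul Z = 1 \<longrightarrow> is_basis smul Z {X})" for X
  have main: "claim (smul cm Xminus - smul cp Xplus)"
    if "balanced_weights d \<theta>s (split_diagonal d \<theta> \<theta>s \<phi>1) cm cp" "cm \<noteq> 0 \<or> cp \<noteq> 0" for cm cp
  proof -
    have "balanced_weights d \<theta>s a cm cp"
      using that(1) by (simp add: balanced_weights_def a_split)
    moreover have "d > 0" using assms(3) by simp
    ultimately show ?thesis
      using balanced_combination_spans_zero_diagonal_space[OF assms(1) _ A As v(2,3,1) inj Es a _ that(2) assms(10,11)]
      by (simp add: claim_def Z_def smul_def)
  qed
  interpret op: vector_space smul
    unfolding smul_def by (rule vector_space_op_scale) (rule assms(1))
  note one = op.scale_one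
  \<comment> \<open>The elements for odd \<open>d\<close> are stated as sums, whereas the weights
    are set up for differences.\<close>
  have plus: "smul c X + smul c' Y = smul c X - smul (- c') Y" for c c' X Y
    by (simp add: op.scale_minus_left)
  note d = assms(3)
  show ?thesis
    unfolding Let_def Z_def[symmetric] smul_def[symmetric] claim_def[symmetric]
  proof (intro conjI allI impI; (elim conjE)?)
    fix q h hs s ss r1 r2
    assume "q_racah_type d \<theta> \<theta>s \<phi>1 \<phi>2 q h hs s ss r1 r2" "ss = r1 ^ 2"
    then show "claim (smul (q ^ d * (r1 + 1) * (r1 * q + 1)) Xminus
        - smul ((r1 * q ^ d + 1) * (r1 * q ^ (d + 1) + 1)) Xplus)"
      using q_racah_weights[OF d inj] main by blast
  next
    fix q h hs s ss r1 r2
    assume "q_racah_type d \<theta> \<theta>s \<phi>1 \<phi>2 q h hs s ss r1 r2" "ss = r2 ^ 2"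
    then have "q_racah_type d \<theta> \<theta>s \<phi>1 \<phi>2 q h hs s (r2 ^ 2) r2 r1"
      using q_racah_type_commute by blast
    then show "claim (smul (q ^ d * (r2 + 1) * (r2 * q + 1)) Xminus
        - smul ((r2 * q ^ d + 1) * (r2 * q ^ (d + 1) + 1)) Xplus)"
      using q_racah_weights[OF d inj] main by blast
  next
    fix q h hs ss r
    assume "q_hahn_type d \<theta> \<theta>s \<phi>1 \<phi>2 q h hs ss r" "ss = r ^ 2"
    then show "claim (smul (q ^ d * (r + 1) * (r * q + 1)) Xminus
        - smul ((r * q ^ d + 1) * (r * q ^ (d + 1) + 1)) Xplus)"
      using q_hahn_weights[OF d inj] main by blast
  next
    fix q h hs s
    assume "dual_q_krawtchouk_type d \<theta> \<theta>s \<phi>1 \<phi>2 q h hs s"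
    then show "claim (smul (q ^ d) Xminus - Xplus)"
      using main[of "q ^ d" 1] dual_q_krawtchouk_weights[OF d inj] one by auto
  next
    fix h hs s ss r1 r2
    assume "racah_type d \<theta> \<theta>s \<phi>1 \<phi>2 h hs s ss r1 r2" "ss = 2 * r1"
    then show "claim (Xminus - Xplus)"
      using main[of 1 1] racah_weights[OF d inj] one by auto
  next
    fix h hs s ss r1 r2
    assume "racah_type d \<theta> \<theta>s \<phi>1 \<phi>2 h hs s ss r1 r2" "ss = 2 * r2"
    then have "racah_type d \<theta> \<theta>s \<phi>1 \<phi>2 h hs s (2 * r2) r2 r1"
      using racah_type_commute by blast
    then show "claim (Xminus - Xplus)"
      using main[of 1 1] racah_weights[OF d inj] one by auto
  next
    fix hs s ss r
    assume "hahn_type d \<theta> \<theta>s \<phi>1 \<phi>2 hs s ss r"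
    then show "claim (smul (ss * (ss + 2)) Xminus
        - smul ((ss + 2 * of_nat d) * (ss + 2 * of_nat d + 2)) Xplus)"
      using hahn_weights[OF d inj] main by blast
  next
    fix s ss r
    assume "krawtchouk_type d \<theta> \<theta>s \<phi>1 \<phi>2 s ss r"
    then show "claim (Xminus - Xplus)"
      using main[of 1 1] krawtchouk_weights[OF d inj] one by auto
  next
    fix h hs s ss r1 r2
    assume "even d" "bannai_ito_type d \<theta> \<theta>s \<phi>1 \<phi>2 h hs s ss r1 r2" "ss = - 2 * r1"
    then show "claim (smul (r1 + 1) Xminus - smul (r1 + of_nat d + 1) Xplus)"
      using bannai_ito_even_weights_1[OF d inj] main by blast
  next
    fix h hs s ss r1 r2
    assume "even d" "bannai_ito_type d \<theta> \<theta>s \<phi>1 \<phi>2 h hs s ss r1 r2" "ss = - 2 * r2"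
    then show "claim (smul r2 Xminus - smul (r2 + of_nat d) Xplus)"
      using bannai_ito_even_weights_2[OF d inj] main by blast
  next
    fix h hs s ss r1 r2
    assume "odd d" "bannai_ito_type d \<theta> \<theta>s \<phi>1 \<phi>2 h hs s ss r1 r2" "ss = - 2 * r1"
    then show "claim (smul r1 Xminus + smul (r1 + of_nat d + 1) Xplus)"
      unfolding plus using bannai_ito_odd_weights_1[OF d inj] main by blast
  next
    fix h hs s ss r1 r2
    assume "odd d" "bannai_ito_type d \<theta> \<theta>s \<phi>1 \<phi>2 h hs s ss r1 r2" "ss = - 2 * r2"
    then show "claim (smul r2 Xminus + smul (r2 + of_nat d + 1) Xplus)"
      unfolding plus using bannai_ito_odd_weights_2[OF d inj] main by blast
  qed
qed

end
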